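(* Let $\mathcal{C}$ be a half-line CMV matrix with spectral measure $\mu$, and for $n\ge0$ let $d\mu_n(\theta)=|\varphi_n(e^{i\theta})|^2\,d\mu(\theta)$. Let $k\in\mathbb{N}$ (so $k<\infty$) and $c\in\overline{\mathbb{D}}\setminus\{0\}$, and suppose that $$\lim_{n\to\infty}\int_0^{2\pi}e^{i\ell\theta}\,d\mu_n(\theta)=\begin{cases}0,&\ell=1,\dots,k-1,\\ c,&\ell=k,\end{cases}$$ and that $\lim_{n\to\infty}\int_0^{2\pi}e^{2ik\theta}\,d\mu_n(\theta)$ exists. Then $d\mu_n$ converges weakly as $n\to\infty$, and $\mathcal{C}$ has a unique right limit (up to a shift and multiplication by a constant phase) in $\mathcal{K}(c,k)$; that is, all right limits of $\mathcal{C}$ lie in $\mathcal{K}(c,k)$ and any two of them have Verblunsky coefficients $\{\beta_n\}_{n\in\mathbb{Z}}$, $\{\beta_n'\}_{n\in\mathbb{Z}}$ related by $\beta'_n=e^{i\phi}\beta_{n+m}$ for all $n\in\mathbb{Z}$, for some $\phi\in\mathbb{R}$, $m\in\mathbb{Z}$.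
   Context: $\mathbb{N}=\{1,2,\dots\}$ and $\mathbb{D}$ is the open unit disc. A probability measure $\mu$ on $\partial\mathbb{D}$ with infinite support has monic orthogonal polynomials $\Phi_n$ (orthonormal versions $\varphi_n$) satisfying $\Phi_{n+1}(z)=z\Phi_n(z)-\overline{\alpha_n}\,\Phi_n^*(z)$, $\Phi_n^*(z)=z^n\overline{\Phi_n(1/\bar z)}$; the numbers $\alpha_n\in\mathbb{D}$ are its Verblunsky coefficients, and $\mu\leftrightarrow\{\alpha_n\}_{n\ge0}\in\mathbb{D}^{\mathbb{Z}_+}$ is a bijection. The half-line CMV matrix of $\{\alpha_n\}_{n\ge 0}$ is the unitary operator on $\ell^2(\mathbb{Z}_+)$ given by $\mathcal{C}=\mathcal{L}\mathcal{M}$, $\mathcal{L}=\Theta_0\oplus\Theta_2\oplus\cdots$, $\mathcal{M}=(1)\oplus\Theta_1\oplus\Theta_3\oplus\cdots$, $\Theta_k=\begin{pmatrix}\bar\alpha_k&\rho_k\\ \rho_k&-\alpha_k\end{pmatrix}$, $\rho_k=(1-|\alpha_k|^2)^{1/2}$; $\mu$ is its spectral measure, and $\mu_n$ is the spectral measure of $\mathcal{C}$ and $\delta_n$. For $\{\beta_n\}_{n\in\mathbb{Z}}$ with $|\beta_n|\le1$, the whole-line CMV matrix is the unitary operator $\mathcal{E}=\mathcal{L}\mathcal{M}$ on $\ell^2(\mathbb{Z})$, with $\mathcal{L}$ the direct sum over $k\in\mathbb{Z}$ of blocks $\Theta_{2k}$ acting on coordinates $2k,2k+1$ and $\mathcal{M}$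 the direct sum of blocks $\Theta_{2k-1}$ acting on coordinates $2k-1,2k$ (with $\Theta_k$ formed from $\beta_k$). $\mathcal{E}$ is a right limit of $\mathcal{C}$ if there are integers $n_j\to\infty$ with $\beta_n=\lim_{j\to\infty}\alpha_{n+n_j}$ for every $n\in\mathbb{Z}$. A whole-line CMV matrix $\mathcal{E}$ belongs to Khrushchev Class if the spectral measures of $\mathcal{E}$ and $\delta_n$ are the same for all $n\in\mathbb{Z}$. $\mathcal{K}(c,k)$ is the set of matrices $\mathcal{E}$ in the Khrushchev Class with $[\mathcal{E}^\ell]_{n,n}=0$ for all $n\in\mathbb{Z}$, $\ell=1,\dots,k-1$, and $[\mathcal{E}^k]_{n,n}=c\ne0$ for all $n\in\mathbb{Z}$. *)

theory Defs
  imports "HOL-Probability.Probability" "HOL-Computational_Algebra.Polynomial"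
begin

section \<open>Measures on the unit circle\<close>

definition unit_circle :: "complex set" where
  "unit_circle = sphere 0 1"

definition circle_measure :: "complex measure \<Rightarrow> bool" where
  "circle_measure \<mu> \<longleftrightarrow>
     finite_measure \<mu> \<and> sets \<mu> = sets (restrict_space borel unit_circle)"

definition weak_conv_circle :: "(nat \<Rightarrow> complex measure) \<Rightarrow> complex measure \<Rightarrow> bool" where
  "weak_conv_circle \<mu>s \<nu> \<longleftrightarrow>
     (\<forall>f :: complex \<Rightarrow> complex. continuous_on unit_circle f \<longrightarrow>
        (\<lambda>n. integral\<^sup>L (\<mu>s n) f) \<longlonglongrightarrow> integral\<^sup>L \<nu> f)"


section \<open>Orthogonal polynomials on the unit circle\<close>

definition is_monic_orthogonal_poly :: "complex measure \<Rightarrow> nat \<Rightarrow> complex poly \<Rightarrow> bool" where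
  "is_monic_orthogonal_poly \<mu> n p \<longleftrightarrow>
     degree p = n \<and> lead_coeff p = 1 \<and>
     (\<forall>j<n. integral\<^sup>L \<mu> (\<lambda>z. cnj (z ^ j) * poly p z) = 0)"

text \<open>Existence and uniqueness hold whenever \<open>\<mu>\<close> has infinite support.\<close>

definition monic_orthogonal_poly :: "complex measure \<Rightarrow> nat \<Rightarrow> complex poly" where
  "monic_orthogonal_poly \<mu> n = (THE p. is_monic_orthogonal_poly \<mu> n p)"

definition orthonormal_poly :: "complex measure \<Rightarrow> nat \<Rightarrow> complex poly" where
  "orthonormal_poly \<mu> n =
     (let \<Phi> = monic_orthogonal_poly \<mu> n
      in smult (complex_of_real (1 / sqrt (integral\<^sup>L \<mu> (\<lambda>z. (cmod (poly \<Phi> z))\<^sup>2)))) \<Phi>)"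

text \<open>\<open>d\<mu>\<^sub>n = |\<phi>\<^sub>n|\<^sup>2 d\<mu>\<close>\<close>

definition op_measure :: "complex measure \<Rightarrow> nat \<Rightarrow> complex measure" where
  "op_measure \<mu> n = density \<mu> (\<lambda>z. ennreal ((cmod (poly (orthonormal_poly \<mu> n) z))\<^sup>2))"


section \<open>Operators on square-summable sequences\<close>

text \<open>
  Operators on \<open>\<ell>\<^sup>2\<close> over an index type (\<^typ>\<open>nat\<close> for the half line, \<^typ>\<open>int\<close> for the
  whole line) act on sequences. All the matrices below have at most two nonzero entries in each
  row, so the sums defining their action are finite and make sense on every sequence; on
  \<open>\<ell>\<^sup>2\<close> the resulting operators are unitary, and they are determined by their restriction to it.
\<close>

type_synonym 'i operator = "('i \<Rightarrow> complex) \<Rightarrow> ('i \<Rightarrow> complex)"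

definition matrix_operator :: "('i \<Rightarrow> 'i \<Rightarrow> complex) \<Rightarrow> 'i operator" where
  "matrix_operator A f = (\<lambda>i. \<Sum>\<^sub>\<infinity>j. A i j * f j)"

definition l2_inner :: "('i \<Rightarrow> complex) \<Rightarrow> ('i \<Rightarrow> complex) \<Rightarrow> complex" where
  "l2_inner f g = (\<Sum>\<^sub>\<infinity>i. cnj (f i) * g i)"

definition delta :: "'i \<Rightarrow> 'i \<Rightarrow> complex" where
  "delta n = (\<lambda>i. if i = n then 1 else 0)"

definition entry :: "'i operator \<Rightarrow> 'i \<Rightarrow> 'i \<Rightarrow> complex" where
  "entry U m n = l2_inner (delta m) (U (delta n))"

text \<open>
  The spectral measure of a unitary operator \<open>U\<close> and a vector \<open>v\<close> in \<open>\<ell>\<^sup>2\<close>: the finite measure on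
  the circle with moments \<open>\<langle>v, U\<^sup>l v\<rangle>\<close>. The moments of negative order need not be
  listed, because \<open>\<langle>v, U\<^sup>* \<^sup>l v\<rangle>\<close> is the complex conjugate of \<open>\<langle>v, U\<^sup>l v\<rangle>\<close>. By density of the
  Laurent polynomials there is only one such measure.
\<close>

definition is_spectral_measure ::
    "'i operator \<Rightarrow> ('i \<Rightarrow> complex) \<Rightarrow> complex measure \<Rightarrow> bool" where
  "is_spectral_measure U v \<nu> \<longleftrightarrow>
     circle_measure \<nu> \<and>
     (\<forall>l::nat. integral\<^sup>L \<nu> (\<lambda>z. z ^ l) = l2_inner v ((U ^^ l) v))"


section \<open>CMV matrices\<close>

definition rho :: "complex \<Rightarrow> complex" where
  "rho a = complex_of_real (sqrt (1 - (cmod a)\<^sup>2))"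

text \<open>
  The \<open>2 \<times> 2\<close> block \<open>\<Theta>\<close> with rows \<open>(cnj a, \<rho>)\<close> and \<open>(\<rho>, -a)\<close>; the index
  \<^const>\<open>False\<close> stands for the first and \<^const>\<open>True\<close> for the second row or column.
\<close>

fun theta :: "complex \<Rightarrow> bool \<Rightarrow> bool \<Rightarrow> complex" where
  "theta a False False = cnj a"
| "theta a False True = rho a"
| "theta a True False = rho a"
| "theta a True True = - a"

text \<open>
  In \<open>L\<close> the block of index \<open>2k\<close> occupies the coordinates \<open>2k, 2k+1\<close>; in \<open>M\<close> the block of index
  \<open>2k-1\<close> occupies the coordinates \<open>2k-1, 2k\<close>, where \<open>k = (i + 1) div 2\<close>.
\<close>

definition half_L :: "(nat \<Rightarrow> complex) \<Rightarrow> nat \<Rightarrow> nat \<Rightarrow> complex" where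
  "half_L \<alpha> i j =
     (if i div 2 = j div 2 then theta (\<alpha> (2 * (i div 2))) (odd i) (odd j) else 0)"

definition half_M :: "(nat \<Rightarrow> complex) \<Rightarrow> nat \<Rightarrow> nat \<Rightarrow> complex" where
  "half_M \<alpha> i j =
     (if i = 0 \<and> j = 0 then 1
      else if (i + 1) div 2 = (j + 1) div 2
      then theta (\<alpha> (2 * ((i + 1) div 2) - 1)) (even i) (even j) else 0)"

definition half_line_CMV :: "(nat \<Rightarrow> complex) \<Rightarrow> nat operator" where
  "half_line_CMV \<alpha> = matrix_operator (half_L \<alpha>) \<circ> matrix_operator (half_M \<alpha>)"

definition whole_L :: "(int \<Rightarrow> complex) \<Rightarrow> int \<Rightarrow> int \<Rightarrow> complex" where
  "whole_L \<beta> i j =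
     (if i div 2 = j div 2 then theta (\<beta> (2 * (i div 2))) (odd i) (odd j) else 0)"

definition whole_M :: "(int \<Rightarrow> complex) \<Rightarrow> int \<Rightarrow> int \<Rightarrow> complex" where
  "whole_M \<beta> i j =
     (if (i + 1) div 2 = (j + 1) div 2
      then theta (\<beta> (2 * ((i + 1) div 2) - 1)) (even i) (even j) else 0)"

definition whole_line_CMV :: "(int \<Rightarrow> complex) \<Rightarrow> int operator" where
  "whole_line_CMV \<beta> = matrix_operator (whole_L \<beta>) \<circ> matrix_operator (whole_M \<beta>)"

definition whole_line_CMV_matrices :: "int operator set" where
  "whole_line_CMV_matrices = {whole_line_CMV \<beta> | \<beta>. \<forall>n. cmod (\<beta> n) \<le> 1}"

text \<open>
  Right limits, in terms of the Verblunsky coefficients. For fixed \<open>n\<close> the index \<open>n + N j\<close> is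
  nonnegative for all large \<open>j\<close>, so the truncation in \<^const>\<open>nat\<close> does not affect the limit.
\<close>

definition is_right_limit :: "(nat \<Rightarrow> complex) \<Rightarrow> (int \<Rightarrow> complex) \<Rightarrow> bool" where
  "is_right_limit \<alpha> \<beta> \<longleftrightarrow>
     (\<exists>N :: nat \<Rightarrow> int. filterlim N at_top sequentially \<and>
        (\<forall>n. (\<lambda>j. \<alpha> (nat (n + N j))) \<longlonglongrightarrow> \<beta> n))"

definition Khrushchev_class :: "int operator set" where
  "Khrushchev_class =
     {E \<in> whole_line_CMV_matrices. \<exists>\<nu>. \<forall>n. is_spectral_measure E (delta n) \<nu>}"

definition Khrushchev_K :: "complex \<Rightarrow> nat \<Rightarrow> int operator set" where
  "Khrushchev_K c k =
     {E \<in> Khrushchev_class. c \<noteq> 0 \<and>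
        (\<forall>n. \<forall>l\<in>{1..<k}. entry (E ^^ l) n n = 0) \<and>
        (\<forall>n. entry (E ^^ k) n n = c)}"

end

theory Submission
  imports Defs
begin

text \<open>
  Each factor of a CMV matrix is a half step of a scattering walk on \<open>\<int>\<close>: a wave at \<open>n\<close> meets the
  bond \<open>n\<close> on its right or the bond \<open>n - 1\<close> on its left and is reflected with amplitude \<open>cnj \<beta>\<^sub>n\<close> or
  \<open>- \<beta>\<^sub>n\<^sub>-\<^sub>1\<close>, or transmitted with amplitude \<open>\<rho>\<close>. The moments of \<open>\<mu>\<^sub>n\<close> are the return amplitudes at \<open>n\<close>,
  so for a right limit all return amplitudes after \<open>1, \<dots>, k - 1\<close> and \<open>k\<close> steps are \<open>0\<close> and \<open>c\<close>. As long as
  the nonzero coefficients are at least \<open>l\<close> apart, a closed path of \<open>l\<close> steps has exactly two reflections,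
  at bonds at distance \<open>l\<close>. Inductively, the nonzero coefficients of a right limit sit on a progression
  \<open>j + k\<int>\<close>, and consecutive ones, \<open>a\<close> and \<open>b\<close>, satisfy \<open>a cnj b = - c\<close>. Their moduli alternate between
  \<open>r\<close> and \<open>|c| / r\<close>, and the return amplitude after \<open>2k\<close> steps determines \<open>r\<^sup>2 + |c|\<^sup>2 / r\<^sup>2\<close>; so the
  right limit is unique up to a shift and a phase. Such a sequence is moreover symmetric, up to a phase,
  under reflection about each nonzero coefficient, which makes the return amplitudes independent of the
  site. Hence all right limits share all their moments, and by compactness the moments of \<open>\<mu>\<^sub>n\<close> converge.
\<close>

section \<open>Half steps of a CMV matrix\<close>

lemma rho_0 [simp]: "rho 0 = 1"
  by (simp add: rho_def)

lemma cnj_rho [simp]: "cnj (rho a) = rho a"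
  by (simp add: rho_def)

lemma rho_mult_rho: "cmod a \<le> 1 \<Longrightarrow> rho a * rho a = 1 - a * cnj a"
  by (simp add: rho_def complex_norm_square abs_square_le_1 flip: of_real_mult of_real_power)

text \<open>The half step is \<open>L\<close> for even and \<open>M\<close> for odd \<open>e\<close>; the bond between \<open>i\<close> and \<open>i + 1\<close> carries
  the coefficient \<open>\<beta> i\<close>.\<close>

definition half_step :: "(int \<Rightarrow> complex) \<Rightarrow> int \<Rightarrow> (int \<Rightarrow> complex) \<Rightarrow> int \<Rightarrow> complex" where
  "half_step \<beta> e f = (\<lambda>i. if even (i + e) then cnj (\<beta> i) * f i + rho (\<beta> i) * f (i + 1)
     else rho (\<beta> (i - 1)) * f (i - 1) - \<beta> (i - 1) * f i)"

text \<open>Half step \<open>s\<close> acts first, then \<open>s + 1\<close>, and so on. Only the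
  parity of \<open>s\<close> counts; keeping an integer lets \<open>s = n\<close> mean that a wave
  at \<open>n\<close> starts across its right bond, and \<open>s = n + 1\<close> across its left
  bond.\<close>

fun evolve :: "(int \<Rightarrow> complex) \<Rightarrow> int \<Rightarrow> nat \<Rightarrow> (int \<Rightarrow> complex) \<Rightarrow> int \<Rightarrow> complex" where
  "evolve \<beta> s 0 f = f"
| "evolve \<beta> s (Suc h) f = half_step \<beta> (s + int h) (evolve \<beta> s h f)"

text \<open>The start index follows the site, so that all sites are treated alike. A diagonal entry
  of a CMV power always starts with \<open>M\<close>; \<open>return_amp_transpose\<close> reconciles
  the two conventions.\<close>

definition return_amp :: "(int \<Rightarrow> complex) \<Rightarrow> nat \<Rightarrow> int \<Rightarrow> complex" where
  "return_amp \<beta> l n = evolve \<beta> n (2 * l) (delta n) n"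

lemma half_step_parity: "even (e - e') \<Longrightarrow> half_step \<beta> e = half_step \<beta> e'"
  by (auto simp: half_step_def fun_eq_iff)

lemma evolve_parity: "even (s - s') \<Longrightarrow> evolve \<beta> s h = evolve \<beta> s' h"
proof (induction h)
  case (Suc h)
  have "even ((s + int h) - (s' + int h))" using Suc.prems by simp
  then have "half_step \<beta> (s + int h) = half_step \<beta> (s' + int h)" by (rule half_step_parity)
  then show ?case using Suc by (intro ext) simp
qed (intro ext, simp)

lemma evolve_add: "evolve \<beta> s (h + h') f = evolve \<beta> (s + int h) h' (evolve \<beta> s h f)"
  by (induction h') (simp_all add: add.assoc)

lemma evolve_Suc_left: "evolve \<beta> s (Suc h) f = evolve \<beta> (s + 1) h (half_step \<beta> s f)"
  using evolve_add[of \<beta> s 1 h f] by simp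

lemma half_step_lin:
  "half_step \<beta> e (\<lambda>i. a * f i + b * g i) = (\<lambda>i. a * half_step \<beta> e f i + b * half_step \<beta> e g i)"
  by (auto simp: half_step_def fun_eq_iff algebra_simps)

lemma evolve_lin:
  "evolve \<beta> s h (\<lambda>i. a * f i + b * g i) = (\<lambda>i. a * evolve \<beta> s h f i + b * evolve \<beta> s h g i)"
  by (induction h) (simp_all add: half_step_lin)

lemma half_step_delta_right:
  "even (n + e) \<Longrightarrow> half_step \<beta> e (delta n) = (\<lambda>i. cnj (\<beta> n) * delta n i + rho (\<beta> n) * delta (n + 1) i)"
  by (auto simp: half_step_def delta_def fun_eq_iff)

lemma half_step_delta_left:
  "odd (n + e) \<Longrightarrow> half_step \<beta> e (delta n) =
     (\<lambda>i. - \<beta> (n - 1) * delta n i + rho (\<beta> (n - 1)) * delta (n - 1) i)"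
  by (auto simp: half_step_def delta_def fun_eq_iff)

section \<open>Symmetries of the walk: translation, reflection, phase\<close>

lemma half_step_shift:
  "half_step (\<lambda>i. \<beta> (i + m)) e (\<lambda>i. f (i + m)) = (\<lambda>i. half_step \<beta> (e + m) f (i + m))"
  by (auto simp: half_step_def fun_eq_iff algebra_simps)

lemma evolve_shift:
  "evolve (\<lambda>i. \<beta> (i + m)) s h (\<lambda>i. f (i + m)) = (\<lambda>i. evolve \<beta> (s + m) h f (i + m))"
  by (induction h) (simp_all add: half_step_shift algebra_simps)

lemma return_amp_shift: "return_amp (\<lambda>i. \<beta> (i + m)) l n = return_amp \<beta> l (n + m)"
proof -
  have "delta n = (\<lambda>i. delta (n + m) (i + m))" by (auto simp: delta_def fun_eq_iff)
  then show ?thesis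
    unfolding return_amp_def using evolve_shift[of \<beta> m n "2 * l" "delta (n + m)"] by simp
qed

text \<open>Sending \<open>i\<close> to \<open>2 * j + 1 - i\<close> fixes bond \<open>j\<close> and
  interchanges left and right, so the reflection amplitudes \<open>cnj a\<close> and
  \<open>- a\<close> trade places, which turns a coefficient \<open>a\<close> into
  \<open>- cnj a\<close>. The parity of a site flips together with its direction, so
  \<open>e\<close> stays.\<close>

lemma half_step_reflect:
  "half_step (\<lambda>i. - cnj (\<beta> (2 * j - i))) e (\<lambda>i. f (2 * j + 1 - i))
     = (\<lambda>i. half_step \<beta> e f (2 * j + 1 - i))"
  by (auto simp: half_step_def fun_eq_iff rho_def algebra_simps)

lemma evolve_reflect:
  "evolve (\<lambda>i. - cnj (\<beta> (2 * j - i))) s h (\<lambda>i. f (2 * j + 1 - i))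
     = (\<lambda>i. evolve \<beta> s h f (2 * j + 1 - i))"
  by (induction h) (simp_all add: half_step_reflect)

text \<open>Conjugation by a diagonal unitary that weights waves facing right by
  \<open>\<zeta>\<close> and waves facing left by \<open>cnj \<zeta>\<close>: transmission keeps the
  direction, reflection reverses it. The weights look exchanged in the output because parity is
  still measured against \<open>e\<close>, while directions now refer to
  \<open>e + 1\<close>.\<close>

lemma half_step_phase:
  assumes "cmod \<zeta> = 1"
  shows "half_step (\<lambda>i. \<zeta>\<^sup>2 * \<beta> i) e (\<lambda>i. (if even (i + e) then \<zeta> else cnj \<zeta>) * f i)
     = (\<lambda>i. (if even (i + e) then cnj \<zeta> else \<zeta>) * half_step \<beta> e f i)"
proof -
  have 1: "\<zeta> * cnj \<zeta> = 1" using assms by (simp flip: complex_norm_square)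
  have 2: "\<zeta> * (cnj \<zeta> * x) = x" "cnj \<zeta> * (\<zeta> * x) = x" for x
    using 1 by (metis mult.assoc mult.commute mult_1)+
  have 3: "rho (\<zeta> * (\<zeta> * x)) = rho x" for x
    using assms by (simp add: rho_def norm_mult norm_power)
  show ?thesis
    by (auto simp: half_step_def fun_eq_iff algebra_simps power2_eq_square 2 3)
qed

lemma evolve_phase:
  assumes "cmod \<zeta> = 1"
  shows "evolve (\<lambda>i. \<zeta>\<^sup>2 * \<beta> i) s h (\<lambda>i. (if even (i + s) then \<zeta> else cnj \<zeta>) * f i)
     = (\<lambda>i. (if even (i + s + int h) then \<zeta> else cnj \<zeta>) * evolve \<beta> s h f i)"
proof (induction h)
  case (Suc h)
  have "(if even (i + s + int (Suc h)) then \<zeta> else cnj \<zeta>) =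
      (if even (i + (s + int h)) then cnj \<zeta> else \<zeta>)" for i
    by auto
  note parity = this
  show ?case
    unfolding evolve.simps Suc parity
    using half_step_phase[OF assms, of \<beta> "s + int h" "evolve \<beta> s h f"]
    by (simp only: add.assoc)
qed simp

text \<open>With \<open>\<zeta>\<close> a square root of \<open>u\<close>, an even number of half
  steps leaves the same weight at \<open>n\<close> at both ends of the path, and it cancels.\<close>

lemma return_amp_phase:
  assumes "cmod u = 1"
  shows "return_amp (\<lambda>i. u * \<beta> i) l n = return_amp \<beta> l n"
proof -
  define \<zeta> where "\<zeta> = csqrt u"
  have \<zeta>: "\<zeta>\<^sup>2 = u" by (simp add: \<zeta>_def)
  have "(cmod \<zeta>)\<^sup>2 = 1" using \<zeta> assms by (metis norm_power)
  then have 1: "cmod \<zeta> = 1" by (simp add: abs_square_eq_1)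
  have \<zeta>0: "\<zeta> \<noteq> 0" using 1 by auto
  have 2: "(\<lambda>i. (if even (i + n) then \<zeta> else cnj \<zeta>) * delta n i) = (\<lambda>i. \<zeta> * delta n i + 0 * delta n i)"
    by (auto simp: delta_def fun_eq_iff)
  have "\<zeta> * evolve (\<lambda>i. \<zeta>\<^sup>2 * \<beta> i) n (2 * l) (delta n) n = \<zeta> * evolve \<beta> n (2 * l) (delta n) n"
    using fun_cong[OF evolve_phase[OF 1, of \<beta> n "2 * l" "delta n"], of n]
    unfolding 2 evolve_lin by simp
  then show ?thesis using \<zeta>0 by (simp add: return_amp_def \<zeta>)
qed

section \<open>Bilinear pairing and transposition\<close>

definition pairing :: "(int \<Rightarrow> complex) \<Rightarrow> (int \<Rightarrow> complex) \<Rightarrow> complex" where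
  "pairing f g = (\<Sum>\<^sub>\<infinity>i. f i * g i)"

abbreviation fin_supp :: "(int \<Rightarrow> complex) \<Rightarrow> bool" where
  "fin_supp f \<equiv> finite {i. f i \<noteq> 0}"

lemma fin_supp_delta [simp]: "fin_supp (delta n)"
  by (rule finite_subset[of _ "{n}"]) (auto simp: delta_def)

lemma fin_supp_lin:
  assumes "fin_supp f" "fin_supp g"
  shows "fin_supp (\<lambda>i. a * f i + b * g i)"
  by (rule finite_subset[OF _ finite_UnI[OF assms]]) auto

lemma fin_supp_half_step:
  assumes "fin_supp f"
  shows "fin_supp (half_step \<beta> e f)"
proof (rule finite_subset)
  let ?S = "{i. f i \<noteq> 0}"
  show "{i. half_step \<beta> e f i \<noteq> 0} \<subseteq> ?S \<union> (\<lambda>i. i + 1) ` ?S \<union> (\<lambda>i. i - 1) ` ?S"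
    by (force simp: half_step_def image_iff split: if_splits)
qed (use assms in auto)

lemma fin_supp_evolve: "fin_supp f \<Longrightarrow> fin_supp (evolve \<beta> s h f)"
  by (induction h) (simp_all add: fin_supp_half_step)

lemma summable_fin_supp:
  fixes f :: "int \<Rightarrow> complex"
  assumes "fin_supp f"
  shows "f summable_on UNIV"
  using summable_on_cong_neutral[of UNIV "{i. f i \<noteq> 0}" f f] summable_on_finite[OF assms, of f] by auto

lemma summable_pairing: "fin_supp f \<Longrightarrow> (\<lambda>i. f i * g i) summable_on UNIV"
  by (rule summable_fin_supp, erule rev_finite_subset) auto

lemma pairing_lin_right:
  assumes "fin_supp f"
  shows "pairing f (\<lambda>i. a * g i + b * h i) = a * pairing f g + b * pairing f h"
proof -
  have "pairing f (\<lambda>i. a * g i + b * h i) = (\<Sum>\<^sub>\<infinity>i. a * (f i * g i) + b * (f i * h i))"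
    by (simp add: pairing_def algebra_simps)
  also have "\<dots> = (\<Sum>\<^sub>\<infinity>i. a * (f i * g i)) + (\<Sum>\<^sub>\<infinity>i. b * (f i * h i))"
    by (intro infsum_add summable_on_cmult_right summable_pairing assms)
  finally show ?thesis
    using summable_pairing[OF assms] by (simp add: pairing_def infsum_cmult_right)
qed

lemma pairing_commute: "pairing f g = pairing g f"
  by (simp add: pairing_def mult.commute)

lemma pairing_delta [simp]: "pairing (delta n) f = f n"
proof -
  have "pairing (delta n) f = infsum (\<lambda>i. delta n i * f i) {n}"
    unfolding pairing_def by (rule infsum_cong_neutral) (auto simp: delta_def)
  then show ?thesis by (simp add: delta_def)
qed

text \<open>The blocks \<open>theta\<close> are symmetric matrices, in general not Hermitian; hence
  a pairing without conjugation.\<close>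

lemma pairing_half_step:
  assumes "fin_supp f"
  shows "pairing (half_step \<beta> e f) g = pairing f (half_step \<beta> e g)"
proof -
  \<comment> \<open>The involution \<open>p\<close> exchanges the two ends of a bond;
    \<open>r\<close> and \<open>a\<close> are the transmission and reflection amplitudes seen from a
    site, and \<open>r\<close> agrees at both ends.\<close>
  define p where "p i = (if even (i + e) then i + 1 else i - 1)" for i :: int
  define r where "r i = (if even (i + e) then rho (\<beta> i) else rho (\<beta> (i - 1)))" for i :: int
  define a where "a i = (if even (i + e) then cnj (\<beta> i) else - \<beta> (i - 1))" for i :: int
  have H: "half_step \<beta> e h = (\<lambda>i. a i * h i + r i * h (p i))" for h
    by (auto simp: half_step_def a_def r_def p_def fun_eq_iff)
  have pp: "p (p i) = i" and rp: "r (p i) = r i" for i by (auto simp: p_def r_def)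
  have bij: "bij_betw p UNIV UNIV" by (rule bij_betw_byWitness[where f' = p]) (auto simp: pp)
  have fp: "fin_supp (\<lambda>i. f (p i))"
    by (rule finite_subset[OF _ finite_imageI[OF assms, of p]]) (auto simp: image_iff, metis pp)
  have S1: "(\<lambda>i. f i * (a i * g i)) summable_on UNIV" "(\<lambda>i. f i * (r i * g (p i))) summable_on UNIV"
    "(\<lambda>i. f (p i) * (r i * g i)) summable_on UNIV"
    by (intro summable_pairing assms fp)+
  have "(\<Sum>\<^sub>\<infinity>i. f (p i) * (r i * g i)) = (\<Sum>\<^sub>\<infinity>i. f i * (r i * g (p i)))"
    using infsum_reindex_bij_betw[OF bij, of "\<lambda>i. f i * (r i * g (p i))"] by (simp add: pp rp)
  moreover have "pairing (half_step \<beta> e f) g = (\<Sum>\<^sub>\<infinity>i. f i * (a i * g i) + f (p i) * (r i * g i))"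
    by (simp add: pairing_def H algebra_simps)
  moreover have "pairing f (half_step \<beta> e g) = (\<Sum>\<^sub>\<infinity>i. f i * (a i * g i) + f i * (r i * g (p i)))"
    by (simp add: pairing_def H algebra_simps)
  ultimately show ?thesis using S1 by (simp add: infsum_add)
qed

text \<open>Transposition reverses the order of the half steps. The last of them has index
  \<open>s + int h - 1\<close>, of the same parity as \<open>s + int h + 1\<close>.\<close>

lemma pairing_evolve:
  "fin_supp g \<Longrightarrow> pairing g (evolve \<beta> s h f) = pairing (evolve \<beta> (s + int h + 1) h g) f"
proof (induction h arbitrary: g)
  case (Suc h)
  have "pairing g (evolve \<beta> s (Suc h) f) = pairing (half_step \<beta> (s + int h) g) (evolve \<beta> s h f)"
    using Suc.prems by (simp add: pairing_half_step)
  also have "\<dots> = pairing (evolve \<beta> (s + int h + 1) h (half_step \<beta> (s + int h) g)) f"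
    using Suc by (simp add: fin_supp_half_step)
  also have "\<dots> = pairing (evolve \<beta> (s + int h) (Suc h) g) f"
    by (simp only: evolve_Suc_left)
  also have "evolve \<beta> (s + int h) (Suc h) g = evolve \<beta> (s + int (Suc h) + 1) (Suc h) g"
    by (rule fun_cong[OF evolve_parity]) simp
  finally show ?case .
qed simp

lemma return_amp_transpose: "evolve \<beta> (n + 1) (2 * l) (delta n) n = return_amp \<beta> l n"
proof -
  have "evolve \<beta> n (2 * l) (delta n) n = pairing (delta n) (evolve \<beta> n (2 * l) (delta n))" by simp
  also have "\<dots> = pairing (evolve \<beta> (n + int (2 * l) + 1) (2 * l) (delta n)) (delta n)"
    by (rule pairing_evolve) simp
  also have "evolve \<beta> (n + int (2 * l) + 1) (2 * l) (delta n) = evolve \<beta> (n + 1) (2 * l) (delta n)"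
    by (rule fun_cong[OF evolve_parity]) simp
  finally show ?thesis
    by (simp add: return_amp_def pairing_commute[of _ "delta n"])
qed

text \<open>The reflection carries site \<open>j\<close> to \<open>j + 1\<close> but keeps the start
  index, so the path now leaves \<open>j + 1\<close> across its left bond; transposition repairs
  this.\<close>

lemma return_amp_reflect:
  "return_amp (\<lambda>i. - cnj (\<beta> (2 * j - i))) l j = return_amp \<beta> l (j + 1)"
proof -
  have "delta j = (\<lambda>i. delta (j + 1) (2 * j + 1 - i))" by (auto simp: delta_def fun_eq_iff)
  then have "return_amp (\<lambda>i. - cnj (\<beta> (2 * j - i))) l j = evolve \<beta> j (2 * l) (delta (j + 1)) (j + 1)"
    unfolding return_amp_def using evolve_reflect[of \<beta> j j "2 * l" "delta (j + 1)"] by simp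
  also have "evolve \<beta> j (2 * l) (delta (j + 1)) = evolve \<beta> ((j + 1) + 1) (2 * l) (delta (j + 1))"
    by (rule fun_cong[OF evolve_parity]) simp
  also have "\<dots> (j + 1) = return_amp \<beta> l (j + 1)" by (rule return_amp_transpose)
  finally show ?thesis .
qed

text \<open>Bond \<open>n\<close> is transparent, so its half step carries \<open>delta n\<close> to
  \<open>delta (n + 1)\<close>. Conjugating by that half step rotates the alternating product by one
  factor.\<close>

lemma return_amp_zero:
  assumes "\<beta> n = 0"
  shows "return_amp \<beta> l (n + 1) = return_amp \<beta> l n"
proof -
  have hs: "half_step \<beta> n (delta n) = delta (n + 1)"
    using assms by (subst half_step_delta_right) auto
  have "return_amp \<beta> l (n + 1) = evolve \<beta> (n + 1) (2 * l) (half_step \<beta> n (delta n)) (n + 1)"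
    by (simp add: return_amp_def hs)
  also have "\<dots> = evolve \<beta> n (Suc (2 * l)) (delta n) (n + 1)"
    by (simp only: evolve_Suc_left)
  also have "\<dots> = half_step \<beta> n (evolve \<beta> n (2 * l) (delta n)) (n + 1)"
    using half_step_parity[of "n + int (2 * l)" n \<beta>] by simp
  also have "\<dots> = return_amp \<beta> l n"
    using assms by (simp add: half_step_def return_amp_def)
  finally show ?thesis .
qed

section \<open>Unitarity of the half step\<close>

lemma half_step_cnj:
  assumes "\<And>n. cmod (\<beta> n) \<le> 1"
  shows "half_step (\<lambda>i. cnj (\<beta> i)) e (half_step \<beta> e f) = f"
proof -
  have r: "rho (\<beta> j) * rho (\<beta> j) = 1 - \<beta> j * cnj (\<beta> j)" for j
    by (rule rho_mult_rho[OF assms])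
  have r': "rho (cnj x) = rho x" for x by (simp add: rho_def)
  show ?thesis
    by (auto simp: half_step_def fun_eq_iff algebra_simps r r')
qed

lemma cnj_half_step: "(\<lambda>i. cnj (half_step \<beta> e f i)) = half_step (\<lambda>i. cnj (\<beta> i)) e (\<lambda>i. cnj (f i))"
  by (auto simp: half_step_def fun_eq_iff rho_def)

abbreviation sesq :: "(int \<Rightarrow> complex) \<Rightarrow> (int \<Rightarrow> complex) \<Rightarrow> complex" where
  "sesq f g \<equiv> pairing (\<lambda>i. cnj (f i)) g"

lemma sesq_half_step:
  assumes "\<And>n. cmod (\<beta> n) \<le> 1" "fin_supp f"
  shows "sesq (half_step \<beta> e f) (half_step \<beta> e g) = sesq f g"
proof -
  have 1: "half_step \<beta> e (half_step (\<lambda>i. cnj (\<beta> i)) e h) = h" for h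
    using half_step_cnj[of "\<lambda>i. cnj (\<beta> i)" e h] assms(1) by simp
  have 2: "fin_supp (half_step (\<lambda>i. cnj (\<beta> i)) e (\<lambda>i. cnj (f i)))"
    by (rule fin_supp_half_step) (simp add: assms)
  show ?thesis
    by (simp add: cnj_half_step 1 flip: pairing_half_step[OF 2])
qed

lemma sesq_evolve:
  assumes "\<And>n. cmod (\<beta> n) \<le> 1" "fin_supp f"
  shows "sesq (evolve \<beta> s h f) (evolve \<beta> s h g) = sesq f g"
  by (induction h) (use assms in \<open>simp_all add: sesq_half_step fin_supp_evolve\<close>)

section \<open>Return amplitudes and gaps between Verblunsky coefficients\<close>

definition gapped :: "(int \<Rightarrow> complex) \<Rightarrow> nat \<Rightarrow> bool" where
  "gapped \<beta> l \<longleftrightarrow> (\<forall>i j. i < j \<and> j < i + int l \<longrightarrow> \<beta> i = 0 \<or> \<beta> j = 0)"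

lemma gappedD: "gapped \<beta> l \<Longrightarrow> i \<noteq> j \<Longrightarrow> \<bar>i - j\<bar> < int l \<Longrightarrow> \<beta> i \<noteq> 0 \<Longrightarrow> \<beta> j = 0"
  unfolding gapped_def by (smt (verit))

lemma half_step_sum:
  "half_step \<beta> e (\<lambda>i. \<Sum>a\<in>A. c a * f a i) = (\<lambda>i. \<Sum>a\<in>A. c a * half_step \<beta> e (f a) i)"
  by (auto simp: half_step_def fun_eq_iff sum_distrib_left sum.distrib sum_subtractf algebra_simps)

lemma half_step_add:
  "half_step \<beta> e (\<lambda>i. f i + g i) = (\<lambda>i. half_step \<beta> e f i + half_step \<beta> e g i)"
  using half_step_lin[of \<beta> e 1 f 1 g] by simp

lemma half_step_scale:
  "half_step \<beta> e (\<lambda>i. a * f i) = (\<lambda>i. a * half_step \<beta> e f i)"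
  using half_step_lin[of \<beta> e a f 0 f] by simp

text \<open>Within \<open>l\<close> half steps a wave that starts at \<open>n\<close> and moves to the right
  meets at most one nonzero coefficient before it is reflected, and none afterwards.\<close>

lemma evolve_gapped_right:
  assumes "gapped \<beta> l" "h \<le> l"
  shows "evolve \<beta> n h (delta n) = (\<lambda>i. (\<Prod>a<h. rho (\<beta> (n + int a))) * delta (n + int h) i
     + (\<Sum>a<h. cnj (\<beta> (n + int a)) * delta (n + 2 * int a + 1 - int h) i))"
  using assms(2)
proof (induction h)
  case (Suc h)
  define R where "R = (\<Prod>a<h. rho (\<beta> (n + int a)))"
  \<comment> \<open>A reflection at bond \<open>n + int h\<close> needs a nonzero coefficient there;
    then all bonds already passed are transparent and the accumulated factor is 1.\<close>
  have R: "R * cnj (\<beta> (n + int h)) = cnj (\<beta> (n + int h))"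
  proof (cases "\<beta> (n + int h) = 0")
    case False
    then have "\<beta> (n + int a) = 0" if "a < h" for a
      using gappedD[OF assms(1), of "n + int h" "n + int a"] that Suc.prems by auto
    then show ?thesis by (simp add: R_def)
  qed simp
  have 1: "half_step \<beta> (n + int h) (delta (n + int h)) =
    (\<lambda>i. cnj (\<beta> (n + int h)) * delta (n + int h) i + rho (\<beta> (n + int h)) * delta (n + int h + 1) i)"
    by (rule half_step_delta_right) simp
  \<comment> \<open>A wave reflected at bond \<open>n + int a\<close> now meets a bond at distance
    \<open>h - a\<close>, which is positive and below \<open>l\<close>, so the coefficient there
    vanishes.\<close>
  have 2: "cnj (\<beta> (n + int a)) * half_step \<beta> (n + int h) (delta (n + 2 * int a + 1 - int h)) i
      = cnj (\<beta> (n + int a)) * delta (n + 2 * int a - int h) i" if "a < h" for a i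
  proof (cases "\<beta> (n + int a) = 0")
    case False
    then have "\<beta> (n + 2 * int a - int h) = 0"
      using gappedD[OF assms(1), of "n + int a" "n + 2 * int a - int h"] that Suc.prems by auto
    moreover have o: "odd (n + 2 * int a + 1 - int h + (n + int h))" by simp
    moreover have e: "n + 2 * int a + 1 - int h - 1 = n + 2 * int a - int h" by simp
    ultimately show ?thesis using half_step_delta_left[OF o, of \<beta>] unfolding e by simp
  qed simp
  have S: "(\<Sum>a<h. cnj (\<beta> (n + int a)) * half_step \<beta> (n + int h) (delta (n + 2 * int a + 1 - int h)) i)
      = (\<Sum>a<h. cnj (\<beta> (n + int a)) * delta (n + 2 * int a - int h) i)" for i
    by (intro sum.cong refl 2) simp
  have "evolve \<beta> n (Suc h) (delta n) = (\<lambda>i. R * half_step \<beta> (n + int h) (delta (n + int h)) i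
     + (\<Sum>a<h. cnj (\<beta> (n + int a)) * half_step \<beta> (n + int h) (delta (n + 2 * int a + 1 - int h)) i))"
    using Suc by (simp add: half_step_add half_step_scale half_step_sum flip: R_def)
  also have "\<dots> = (\<lambda>i. R * rho (\<beta> (n + int h)) * delta (n + int h + 1) i
     + (R * cnj (\<beta> (n + int h)) * delta (n + int h) i
     + (\<Sum>a<h. cnj (\<beta> (n + int a)) * delta (n + 2 * int a - int h) i)))"
    unfolding 1 S by (simp add: algebra_simps)
  finally have "evolve \<beta> n (Suc h) (delta n) = \<dots>" .
  moreover have "n + 2 * int h + 1 - int (Suc h) = n + int h"
    "n + 2 * int a + 1 - int (Suc h) = n + 2 * int a - int h"
    "n + int h + 1 = n + int (Suc h)" for a
    by simp_all
  ultimately show ?case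
    by (simp only: R[unfolded R_def] R_def sum.lessThan_Suc prod.lessThan_Suc add.commute[of "sum _ _"])
qed simp

text \<open>The mirror image of \<open>evolve_gapped_right\<close> under the reflection about bond
  0, which sends \<open>i\<close> to \<open>1 - i\<close>.\<close>

lemma evolve_gapped_left:
  assumes "gapped \<beta> l" "h \<le> l"
  shows "evolve \<beta> (n + 1) h (delta n) = (\<lambda>i. (\<Prod>a<h. rho (\<beta> (n - 1 - int a))) * delta (n - int h) i
     - (\<Sum>a<h. \<beta> (n - 1 - int a) * delta (n - 1 - 2 * int a + int h) i))"
proof -
  define \<beta>' where "\<beta>' = (\<lambda>i. - cnj (\<beta> (- i)))"
  have g: "gapped \<beta>' l"
    unfolding gapped_def
  proof (intro allI impI, elim conjE)
    fix i j :: int assume "i < j" "j < i + int l"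
    then show "\<beta>' i = 0 \<or> \<beta>' j = 0"
      using gappedD[OF assms(1), of "- i" "- j"] by (auto simp: \<beta>'_def)
  qed
  have b: "(\<lambda>i. - cnj (\<beta>' (2 * 0 - i))) = \<beta>" by (simp add: \<beta>'_def)
  have d: "delta n = (\<lambda>i. delta (1 - n) (2 * 0 + 1 - i))" by (auto simp: delta_def fun_eq_iff)
  have r: "rho (\<beta>' j) = rho (\<beta> (- j))" for j by (simp add: rho_def \<beta>'_def)
  have "evolve \<beta> (n + 1) h (delta n) = evolve \<beta> (1 - n) h (delta n)"
    by (rule fun_cong[OF evolve_parity]) simp
  also have "\<dots> = (\<lambda>i. evolve \<beta>' (1 - n) h (delta (1 - n)) (1 - i))"
    using evolve_reflect[of \<beta>' 0 "1 - n" h "delta (1 - n)"] unfolding b d[symmetric] by simp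
  also have "\<dots> = (\<lambda>i. (\<Prod>a<h. rho (\<beta> (n - 1 - int a))) * delta (1 - n + int h) (1 - i)
     + (\<Sum>a<h. - \<beta> (n - 1 - int a) * delta (1 - n + 2 * int a + 1 - int h) (1 - i)))"
    unfolding evolve_gapped_right[OF g assms(2)] r by (simp add: \<beta>'_def algebra_simps)
  also have "\<dots> = (\<lambda>i. (\<Prod>a<h. rho (\<beta> (n - 1 - int a))) * delta (n - int h) i
     + (\<Sum>a<h. - \<beta> (n - 1 - int a) * delta (n - 1 - 2 * int a + int h) i))"
    by (intro ext arg_cong2[where f = "(+)"] arg_cong2[where f = "(*)"] sum.cong refl)
      (auto simp: delta_def)
  finally show ?thesis by (simp add: sum_negf)
qed

text \<open>The closed path is cut in the middle, and its second half is transposed into a path that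
  leaves \<open>n\<close> across the left bond.\<close>

lemma return_amp_split:
  "return_amp \<beta> l n = pairing (evolve \<beta> (n + 1) l (delta n)) (evolve \<beta> n l (delta n))"
proof -
  have "return_amp \<beta> l n = pairing (delta n) (evolve \<beta> (n + int l) l (evolve \<beta> n l (delta n)))"
    using evolve_add[of \<beta> n l l "delta n"] by (simp add: return_amp_def mult_2)
  also have "\<dots> = pairing (evolve \<beta> (n + int l + int l + 1) l (delta n)) (evolve \<beta> n l (delta n))"
    by (rule pairing_evolve) simp
  also have "evolve \<beta> (n + int l + int l + 1) l (delta n) = evolve \<beta> (n + 1) l (delta n)"
    by (rule fun_cong[OF evolve_parity]) simp
  finally show ?thesis .
qed

lemma pairing_sum_right:
  assumes "finite A" "fin_supp f"
  shows "pairing f (\<lambda>i. \<Sum>a\<in>A. c a * g a i) = (\<Sum>a\<in>A. c a * pairing f (g a))"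
  using assms(1)
proof (induction A)
  case (insert x A)
  then show ?case
    using pairing_lin_right[OF assms(2), of "c x" "g x" 1 "\<lambda>i. \<Sum>a\<in>A. c a * g a i"] by simp
qed (simp add: pairing_def)

text \<open>Each half path is transmitted throughout or reflected once, and the two halves meet only
  if they are reflected at bonds exactly \<open>l\<close> apart, one on each side of
  \<open>n\<close>. The sign is that of the amplitude of the left reflection.\<close>

lemma return_amp_gapped:
  assumes "gapped \<beta> l" "l \<ge> 1"
  shows "return_amp \<beta> l n = - (\<Sum>b<l. \<beta> (n - 1 - int b) * cnj (\<beta> (n - 1 - int b + int l)))"
proof -
  define g where "g = evolve \<beta> n l (delta n)"
  have fg: "fin_supp g" by (simp add: g_def fin_supp_evolve)
  have g1: "g (n - int l) = 0"
    unfolding g_def evolve_gapped_right[OF assms(1) order_refl] using assms(2)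
    by (auto simp: delta_def intro!: sum.neutral)
  \<comment> \<open>This site is reached by a reflected path only for \<open>a = l - 1 - b\<close>,
    which puts the right bond at \<open>n - 1 - int b + int l\<close>.\<close>
  have g2: "g (n - 1 - 2 * int b + int l) = cnj (\<beta> (n - 1 - int b + int l))" if "b < l" for b
  proof -
    have 1: "cnj (\<beta> (n + int a)) * delta (n + 2 * int a + 1 - int l) (n - 1 - 2 * int b + int l)
        = (if a = l - 1 - b then cnj (\<beta> (n + int a)) else 0)" if "a \<in> {..<l}" for a
      using that \<open>b < l\<close> by (auto simp: delta_def)
    have 2: "delta (n + int l) (n - 1 - 2 * int b + int l) = 0"
      by (simp add: delta_def)
    have "(\<Sum>a<l. cnj (\<beta> (n + int a)) * delta (n + 2 * int a + 1 - int l) (n - 1 - 2 * int b + int l))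
        = (\<Sum>a<l. if a = l - 1 - b then cnj (\<beta> (n + int a)) else 0)"
      by (intro sum.cong refl 1)
    then have "g (n - 1 - 2 * int b + int l) =
        (\<Sum>a<l. if a = l - 1 - b then cnj (\<beta> (n + int a)) else 0)"
      unfolding g_def evolve_gapped_right[OF assms(1) order_refl] 2 by (simp only: mult_zero_right add_0)
    also have "\<dots> = cnj (\<beta> (n + int (l - 1 - b)))" using that by simp
    also have "n + int (l - 1 - b) = n - 1 - int b + int l" using that by (simp add: of_nat_diff)
    finally show ?thesis .
  qed
  have "return_amp \<beta> l n = pairing g (evolve \<beta> (n + 1) l (delta n))"
    by (simp add: return_amp_split pairing_commute g_def)
  also have "\<dots> = (\<Prod>a<l. rho (\<beta> (n - 1 - int a))) * pairing g (delta (n - int l))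
     + (- 1) * pairing g (\<lambda>i. \<Sum>a<l. \<beta> (n - 1 - int a) * delta (n - 1 - 2 * int a + int l) i)"
    unfolding evolve_gapped_left[OF assms(1) order_refl]
    by (subst pairing_lin_right[OF fg, symmetric]) simp
  also have "pairing g (\<lambda>i. \<Sum>a<l. \<beta> (n - 1 - int a) * delta (n - 1 - 2 * int a + int l) i)
     = (\<Sum>b<l. \<beta> (n - 1 - int b) * cnj (\<beta> (n - 1 - int b + int l)))"
    unfolding pairing_sum_right[OF finite_lessThan fg]
    by (rule sum.cong) (simp_all add: pairing_commute[of g] g2)
  finally show ?thesis by (simp add: pairing_commute[of g] g1)
qed

text \<open>Seen from the site just right of bond \<open>j\<close>, every other left bond in the sum
  is closer than \<open>l\<close> to \<open>j\<close> and carries coefficient 0.\<close>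

lemma return_amp_gapped_right:
  assumes "gapped \<beta> l" "l \<ge> 1" "\<beta> j \<noteq> 0"
  shows "return_amp \<beta> l (j + 1) = - (\<beta> j * cnj (\<beta> (j + int l)))"
proof -
  have "(\<Sum>b<l. \<beta> (j + 1 - 1 - int b) * cnj (\<beta> (j + 1 - 1 - int b + int l)))
     = (\<Sum>b<l. if b = 0 then \<beta> j * cnj (\<beta> (j + int l)) else 0)"
    using gappedD[OF assms(1) _ _ assms(3)] by (intro sum.cong) auto
  then show ?thesis using return_amp_gapped[OF assms(1,2), of "j + 1"] assms(2) by simp
qed

text \<open>Here \<open>j\<close> is the right bond of the surviving pair, and the gap removes all
  other right bonds.\<close>

lemma return_amp_gapped_left:
  assumes "gapped \<beta> l" "l \<ge> 1" "\<beta> j \<noteq> 0"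
  shows "return_amp \<beta> l j = - (\<beta> (j - int l) * cnj (\<beta> j))"
proof -
  have "(\<Sum>b<l. \<beta> (j - 1 - int b) * cnj (\<beta> (j - 1 - int b + int l)))
     = (\<Sum>b<l. if b = l - 1 then \<beta> (j - int l) * cnj (\<beta> j) else 0)"
  proof (intro sum.cong refl)
    fix b assume b: "b \<in> {..<l}"
    show "\<beta> (j - 1 - int b) * cnj (\<beta> (j - 1 - int b + int l))
       = (if b = l - 1 then \<beta> (j - int l) * cnj (\<beta> j) else 0)"
    proof (cases "b = l - 1")
      case True
      then have "j - 1 - int b = j - int l" "j - 1 - int b + int l = j"
        using assms(2) by (simp_all add: of_nat_diff)
      then show ?thesis using True by simp
    next
      case False
      have "\<beta> (j - 1 - int b + int l) = 0"
        using False b by (intro gappedD[OF assms(1) _ _ assms(3)]) auto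
      then show ?thesis using False by simp
    qed
  qed
  then show ?thesis using return_amp_gapped[OF assms(1,2), of j] assms(2) by simp
qed

text \<open>Once distances below \<open>k\<close> are excluded, the amplitude after \<open>k\<close>
  steps at \<open>i + 1\<close> is the single product for the bonds \<open>i\<close> and
  \<open>i + int k\<close> when \<open>\<beta> i\<close> is nonzero; its vanishing excludes the
  distance \<open>k\<close> too.\<close>

lemma gapped_of_return_amp:
  assumes "\<And>l n. l \<in> {1..<k} \<Longrightarrow> return_amp \<beta> l n = 0" "k \<ge> 1"
  shows "gapped \<beta> k"
  using assms(2,1)
proof (induction k rule: dec_induct)
  case base
  show ?case by (auto simp: gapped_def)
next
  case (step k)
  then have g: "gapped \<beta> k" by auto
  show ?case
    unfolding gapped_def
  proof (intro allI impI, elim conjE)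
    fix i j :: int assume ij: "i < j" "j < i + int (Suc k)"
    show "\<beta> i = 0 \<or> \<beta> j = 0"
    proof (cases "j = i + int k")
      case True
      then show ?thesis using return_amp_gapped_right[OF g _, of i] step by auto
    next
      case False
      then show ?thesis using g ij by (auto simp: gapped_def)
    qed
  qed
qed

definition sieved :: "(int \<Rightarrow> complex) \<Rightarrow> int \<Rightarrow> nat \<Rightarrow> complex \<Rightarrow> bool" where
  "sieved \<beta> j k c \<longleftrightarrow>
     (\<forall>m. \<beta> (j + int k * m) * cnj (\<beta> (j + int k * (m + 1))) = - c) \<and>
     (\<forall>n. \<not> int k dvd n - j \<longrightarrow> \<beta> n = 0)"

text \<open>Some coefficient is nonzero because \<open>c\<close> is. The amplitudes at the two ends
  of its bond force nonzero coefficients at distance \<open>k\<close> on both sides, and the gap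
  leaves no room for others.\<close>

lemma sieved_of_return_amp:
  assumes "k \<ge> 1" "c \<noteq> 0"
    and "\<And>l n. l \<in> {1..<k} \<Longrightarrow> return_amp \<beta> l n = 0" "\<And>n. return_amp \<beta> k n = c"
  obtains j where "sieved \<beta> j k c"
proof -
  have g: "gapped \<beta> k" using gapped_of_return_amp assms by blast
  have "\<exists>j. \<beta> j \<noteq> 0"
  proof (rule ccontr)
    assume "\<not> (\<exists>j. \<beta> j \<noteq> 0)"
    then have "return_amp \<beta> k 0 = 0" using return_amp_gapped[OF g assms(1), of 0] by simp
    then show False using assms(2,4) by simp
  qed
  then obtain j where j: "\<beta> j \<noteq> 0" by blast
  have up: "\<beta> i * cnj (\<beta> (i + int k)) = - c" if "\<beta> i \<noteq> 0" for i
    using return_amp_gapped_right[OF g assms(1) that] assms(4)[of "i + 1"] by simp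
  have down: "\<beta> (i - int k) \<noteq> 0" if "\<beta> i \<noteq> 0" for i
    using return_amp_gapped_left[OF g assms(1) that] assms(2,4) by auto
  have nz: "\<beta> (j + int k * m) \<noteq> 0" for m
  proof (induction m rule: int_induct[of _ 0])
    case base
    show ?case using j by simp
  next
    case (step1 m)
    then show ?case using up[of "j + int k * m"] assms(2) by (auto simp: algebra_simps)
  next
    case (step2 m)
    then show ?case using down[of "j + int k * m"] by (auto simp: algebra_simps)
  qed
  have "\<beta> n = 0" if "\<not> int k dvd n - j" for n
  proof -
    \<comment> \<open>\<open>q\<close> is the last point of the progression not beyond
      \<open>n\<close>; a point \<open>n\<close> off the progression is closer than \<open>k\<close>
      to it.\<close>
    define q where "q = j + int k * ((n - j) div int k)"
    have "n - q = (n - j) mod int k" using minus_mult_div_eq_mod[of "n - j" "int k"] by (simp add: q_def)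
    moreover have "(n - j) mod int k \<noteq> 0" using that by (simp add: dvd_eq_mod_eq_0)
    ultimately have "q \<noteq> n" "\<bar>q - n\<bar> < int k"
      using assms(1) pos_mod_bound[of "int k" "n - j"] pos_mod_sign[of "int k" "n - j"] by linarith+
    then show ?thesis using gappedD[OF g] nz[of "(n - j) div int k"] by (simp add: q_def)
  qed
  then have "sieved \<beta> j k c"
    using up[OF nz] by (auto simp: sieved_def algebra_simps)
  then show ?thesis by (rule that)
qed

lemma sieved_nonzero: "sieved \<beta> j k c \<Longrightarrow> c \<noteq> 0 \<Longrightarrow> \<beta> (j + int k * m) \<noteq> 0"
  unfolding sieved_def by (metis mult_zero_left neg_equal_0_iff_equal)

lemma sieved_gapped:
  assumes "sieved \<beta> j k c"
  shows "gapped \<beta> k"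
  unfolding gapped_def
proof (intro allI impI, elim conjE)
  fix i i' assume i: "i < i'" "i' < i + int k"
  have "\<not> int k dvd i' - i" using i zdvd_imp_le[of "int k" "i' - i"] by auto
  then have "\<not> int k dvd i - j \<or> \<not> int k dvd i' - j"
    using dvd_diff[of "int k" "i' - j" "i - j"] by auto
  then show "\<beta> i = 0 \<or> \<beta> i' = 0" using assms by (auto simp: sieved_def)
qed

section \<open>Sieved coefficient sequences\<close>

context
  fixes \<beta> :: "int \<Rightarrow> complex" and j :: int and k :: nat and c :: complex
  assumes sieved: "sieved \<beta> j k c" and k: "k \<ge> 1" and c: "c \<noteq> 0"
begin

private abbreviation "\<gamma> \<equiv> \<lambda>q. \<beta> (j + int k * q)"

private lemma \<gamma>_nz: "\<gamma> q \<noteq> 0"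
  using sieved_nonzero[OF sieved c] .

private lemma \<gamma>_rel: "\<gamma> q * cnj (\<gamma> (q + 1)) = - c"
  using sieved by (simp add: sieved_def)

private lemma \<gamma>_up: "\<gamma> (q + 1) = - cnj c / cnj (\<gamma> q)"
proof -
  have "cnj (\<gamma> q * cnj (\<gamma> (q + 1))) = cnj (- c)" by (simp only: \<gamma>_rel)
  then show ?thesis using \<gamma>_nz[of q] by (simp add: field_simps)
qed

private lemma \<gamma>_down: "\<gamma> (q - 1) = - c / cnj (\<gamma> q)"
  using \<gamma>_rel[of "q - 1"] \<gamma>_nz[of q] by (simp add: field_simps)

private lemma off: "\<not> int k dvd n - j \<Longrightarrow> \<beta> n = 0"
  using sieved by (auto simp: sieved_def)

lemma sieved_recentre: "sieved \<beta> (j + int k * m) k c"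
  unfolding sieved_def
proof (intro conjI allI impI)
  fix q
  show "\<beta> (j + int k * m + int k * q) * cnj (\<beta> (j + int k * m + int k * (q + 1))) = - c"
    using \<gamma>_rel[of "m + q"] by (simp add: algebra_simps)
next
  fix n assume n: "\<not> int k dvd n - (j + int k * m)"
  have "\<not> int k dvd n - j"
  proof
    assume "int k dvd n - j"
    then have "int k dvd (n - j) - int k * m" by (rule dvd_diff) simp
    then show False using n by (simp add: algebra_simps)
  qed
  then show "\<beta> n = 0" by (rule off)
qed

text \<open>Mirrored and conjugated, the sequence obeys the same recursion
  \<open>\<gamma>_up\<close> as every unimodular multiple of the original; agreement at
  \<open>j\<close> fixes the multiple. Conjugating the identity gives the other side of
  \<open>j\<close>.\<close>

lemma sieved_reflect:
  "(\<lambda>i. - cnj (\<beta> (2 * j - i))) = (\<lambda>i. (- cnj (\<beta> j) / \<beta> j) * \<beta> i)"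
proof -
  define u where "u = - cnj (\<beta> j) / \<beta> j"
  have j: "\<beta> j \<noteq> 0" using \<gamma>_nz[of 0] by simp
  have u: "u * cnj u = 1" using j by (simp add: u_def)
  have pos: "- cnj (\<gamma> (- int q)) = u * \<gamma> (int q)" for q
  proof (induction q)
    case 0
    show ?case using j by (simp add: u_def)
  next
    case (Suc q)
    have "cnj (- cnj (\<gamma> (- int q))) = cnj (u * \<gamma> (int q))" by (simp only: Suc)
    then have "- \<gamma> (- int q) = cnj u * cnj (\<gamma> (int q))" by simp
    then have 1: "\<gamma> (- int q) = - cnj u * cnj (\<gamma> (int q))" by (metis minus_minus mult_minus_left)
    have u0: "u \<noteq> 0" using u by auto
    have "- cnj (\<gamma> (- int q - 1)) = cnj c / \<gamma> (- int q)"
      unfolding \<gamma>_down by simp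
    also have "\<dots> = u * (u * cnj u) * \<gamma> (int q + 1) / (u * cnj u)"
      unfolding 1 \<gamma>_up using u0 \<gamma>_nz[of "int q"] u by (simp add: field_simps)
    finally show ?case using u by (simp add: algebra_simps)
  qed
  have neg: "- cnj (\<gamma> (int q)) = u * \<gamma> (- int q)" for q
  proof -
    have "cnj (- cnj (\<gamma> (- int q))) = cnj (u * \<gamma> (int q))" by (simp only: pos)
    then have "- \<gamma> (- int q) = cnj u * cnj (\<gamma> (int q))" by simp
    then have "\<gamma> (- int q) = - cnj u * cnj (\<gamma> (int q))" by (metis minus_minus mult_minus_left)
    then have "u * \<gamma> (- int q) = - (u * cnj u) * cnj (\<gamma> (int q))" by simp
    then show ?thesis by (simp add: u)
  qed
  have "- cnj (\<beta> (2 * j - i)) = u * \<beta> i" for i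
  proof (cases "int k dvd i - j")
    case True
    then obtain q where q: "i = j + int k * q" by (metis add.commute diff_add_cancel dvdE)
    show ?thesis
    proof (cases "q \<ge> 0")
      case True
      then show ?thesis using pos[of "nat q"] by (simp add: q)
    next
      case False
      then show ?thesis using neg[of "nat (- q)"] by (simp add: q)
    qed
  next
    case False
    moreover have "(2 * j - i) - j = - (i - j)" by simp
    ultimately have "\<not> int k dvd (2 * j - i) - j" by (simp only: dvd_minus_iff not_False_eq_True)
    then show ?thesis using False by (simp add: off)
  qed
  then show ?thesis by (simp add: u_def)
qed

text \<open>Reflection about bond \<open>j\<close> exchanges the sites \<open>j\<close> and
  \<open>j + 1\<close>, and the phase it introduces is invisible to return amplitudes.\<close>

lemma sieved_return_amp_step: "return_amp \<beta> l (j + 1) = return_amp \<beta> l j"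
proof -
  have "cmod (- cnj (\<beta> j) / \<beta> j) = 1" using \<gamma>_nz[of 0] by (simp add: norm_divide)
  then show ?thesis
    using return_amp_reflect[of \<beta> j l] return_amp_phase[of "- cnj (\<beta> j) / \<beta> j" \<beta> l j]
    unfolding sieved_reflect by simp
qed

text \<open>The waves about to hit the bond \<open>j + k q\<close> from the left and the bond \<open>j + k (q - 1)\<close> from
  the right. On these, \<open>k\<close> half steps act as one half step with the coefficients \<open>\<gamma>\<close>.\<close>

private abbreviation "eR q \<equiv> delta (j + int k * q)"
private abbreviation "eL q \<equiv> delta (j + int k * (q - 1) + 1)"

text \<open>\<open>t\<close> counts blocks, and \<open>even (q + t)\<close> makes
  \<open>eR q\<close> face right when the block starts. Both outgoing waves satisfy the parity
  conditions for \<open>t + 1\<close>, so blocks can be chained. The coefficients strictly inside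
  the block vanish, which leaves only the terms for \<open>a = 0\<close>.\<close>

private lemma block_right:
  assumes "even (q + t)"
  shows "evolve \<beta> (j + int k * t) k (eR q) = (\<lambda>i. rho (\<gamma> q) * eR (q + 1) i + cnj (\<gamma> q) * eL q i)"
proof -
  define n where "n = j + int k * q"
  have "int k * q - int k * t = int k * (q + t - 2 * t)" by (simp add: algebra_simps)
  then have "even (n - (j + int k * t))" using assms by (simp add: n_def)
  then have par: "evolve \<beta> (j + int k * t) k (delta n) = evolve \<beta> n k (delta n)"
    using evolve_parity by metis
  have z: "\<beta> (n + int a) = 0" if "a < k" "a \<noteq> 0" for a
    using gappedD[OF sieved_gapped[OF sieved], of n "n + int a"] \<gamma>_nz[of q] that by (simp add: n_def)
  have "(\<Prod>a<k. rho (\<beta> (n + int a))) = (\<Prod>a<k. if a = 0 then rho (\<beta> n) else 1)"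
    by (rule prod.cong) (auto simp: z)
  moreover have "(\<Sum>a<k. cnj (\<beta> (n + int a)) * delta (n + 2 * int a + 1 - int k) i)
      = (\<Sum>a<k. if a = 0 then cnj (\<beta> n) * delta (n + 1 - int k) i else 0)" for i
    by (rule sum.cong) (auto simp: z)
  ultimately show ?thesis
    using evolve_gapped_right[OF sieved_gapped[OF sieved] order_refl, of n] k
    unfolding par[unfolded n_def] by (simp add: n_def algebra_simps)
qed

private lemma block_left:
  assumes "odd (q + t)"
  shows "evolve \<beta> (j + int k * t) k (eL q) =
     (\<lambda>i. rho (\<gamma> (q - 1)) * eL (q - 1) i - \<gamma> (q - 1) * eR q i)"
proof -
  define n where "n = j + int k * (q - 1) + 1"
  have "int k * (q - 1) - int k * t = int k * (q + t - 1 - 2 * t)" by (simp add: algebra_simps)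
  then have "even (j + int k * t - (n + 1))" using assms by (simp add: n_def)
  then have par: "evolve \<beta> (j + int k * t) k (delta n) = evolve \<beta> (n + 1) k (delta n)"
    using evolve_parity by metis
  have z: "\<beta> (n - 1 - int a) = 0" if "a < k" "a \<noteq> 0" for a
    using gappedD[OF sieved_gapped[OF sieved], of "n - 1" "n - 1 - int a"] \<gamma>_nz[of "q - 1"] that
    by (simp add: n_def)
  have "(\<Prod>a<k. rho (\<beta> (n - 1 - int a))) = (\<Prod>a<k. if a = 0 then rho (\<beta> (n - 1)) else 1)"
    by (rule prod.cong) (auto simp: z)
  moreover have "(\<Sum>a<k. \<beta> (n - 1 - int a) * delta (n - 1 - 2 * int a + int k) i)
      = (\<Sum>a<k. if a = 0 then \<beta> (n - 1) * delta (n - 1 + int k) i else 0)" for i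
    by (rule sum.cong) (auto simp: z)
  ultimately show ?thesis
    using evolve_gapped_left[OF sieved_gapped[OF sieved] order_refl, of n] k
    unfolding par[unfolded n_def] by (simp add: n_def algebra_simps)
qed

private lemma two_blocks_right:
  assumes "even (q + t)"
  shows "evolve \<beta> (j + int k * t) (2 * k) (eR q) =
     (\<lambda>i. rho (\<gamma> q) * (rho (\<gamma> (q + 1)) * eR (q + 2) i + cnj (\<gamma> (q + 1)) * eL (q + 1) i)
        + cnj (\<gamma> q) * (rho (\<gamma> (q - 1)) * eL (q - 1) i - \<gamma> (q - 1) * eR q i))"
proof -
  have t: "j + int k * t + int k = j + int k * (t + 1)" by (simp add: algebra_simps)
  have q: "q + 1 + 1 = q + 2" by simp
  have par: "even (q + 1 + (t + 1))" "odd (q + (t + 1))" using assms by auto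
  show ?thesis
    unfolding mult_2 evolve_add block_right[OF assms] evolve_lin t
    unfolding block_right[OF par(1)] block_left[OF par(2)] q by simp
qed

private lemma two_blocks_left:
  assumes "odd (q + t)"
  shows "evolve \<beta> (j + int k * t) (2 * k) (eL q) =
     (\<lambda>i. rho (\<gamma> (q - 1)) * (rho (\<gamma> (q - 2)) * eL (q - 2) i - \<gamma> (q - 2) * eR (q - 1) i)
        - \<gamma> (q - 1) * (rho (\<gamma> q) * eR (q + 1) i + cnj (\<gamma> q) * eL q i))"
proof -
  have t: "j + int k * t + int k = j + int k * (t + 1)" by (simp add: algebra_simps)
  have q: "q - 1 - 1 = q - 2" by simp
  have par: "odd (q - 1 + (t + 1))" "even (q + (t + 1))" using assms by auto
  have "evolve \<beta> (j + int k * t) (2 * k) (eL q) = evolve \<beta> (j + int k * (t + 1)) k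
      (\<lambda>i. rho (\<gamma> (q - 1)) * eL (q - 1) i + (- \<gamma> (q - 1)) * eR q i)"
    unfolding mult_2 evolve_add block_left[OF assms] t by simp
  also have "\<dots> = (\<lambda>i. rho (\<gamma> (q - 1)) * (rho (\<gamma> (q - 1 - 1)) * eL (q - 1 - 1) i - \<gamma> (q - 1 - 1) * eR (q - 1) i)
        + (- \<gamma> (q - 1)) * (rho (\<gamma> q) * eR (q + 1) i + cnj (\<gamma> q) * eL q i))"
    unfolding evolve_lin by (simp only: block_left[OF par(1)] block_right[OF par(2)])
  finally show ?thesis unfolding q by simp
qed

text \<open>The \<open>4 * k\<close> half steps form four blocks, taken two at a time: this is a
  return amplitude after two full steps for the coefficients \<open>\<gamma>\<close>.\<close>

private lemma return_amp_expand:
  "return_amp \<beta> (2 * k) j = (cnj (\<gamma> 0))\<^sup>2 * (\<gamma> (- 1))\<^sup>2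
     - cnj (\<gamma> 0) * \<gamma> (- 2) * (rho (\<gamma> (- 1)))\<^sup>2 - (rho (\<gamma> 0))\<^sup>2 * cnj (\<gamma> 1) * \<gamma> (- 1)"
proof -
  define P where "P = evolve \<beta> (j + int k * 2) (2 * k)"
  have P_add: "P (\<lambda>i. f i + g i) i = P f i + P g i" for f g i
    using evolve_lin[of \<beta> "j + int k * 2" "2 * k" 1 f 1 g] by (simp add: P_def)
  have P_scale: "P (\<lambda>i. a * f i) i = a * P f i" for a f i
    using evolve_lin[of \<beta> "j + int k * 2" "2 * k" a f 0 f] by (simp add: P_def)
  have "int k \<noteq> 0" using k by simp
  have e0: "eR q j = (if q = 0 then 1 else 0)" for q using k by (auto simp: delta_def)
  \<comment> \<open>For \<open>k = 1\<close> the vector \<open>eL 0\<close> also sits at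
    \<open>j\<close>. Only odd \<open>q\<close> occur in \<open>eL q\<close> after an even number of
    blocks from \<open>eR 0\<close>, so the parity argument excludes it.\<close>
  have e1: "eL q j = 0" if "odd q" for q
  proof -
    have "int k * (q - 1) \<noteq> - 1"
    proof
      assume a: "int k * (q - 1) = - 1"
      have "even (int k * (q - 1))" using that by simp
      then show False unfolding a by simp
    qed
    then show ?thesis by (simp add: delta_def)
  qed
  have R: "P (eR q) j = rho (\<gamma> q) * (rho (\<gamma> (q + 1)) * eR (q + 2) j) - cnj (\<gamma> q) * (\<gamma> (q - 1) * eR q j)"
    if "even q" for q
    using two_blocks_right[of q 2] that e1[of "q + 1"] e1[of "q - 1"] by (simp add: P_def)
  have L: "P (eL q) j = - rho (\<gamma> (q - 1)) * (\<gamma> (q - 2) * eR (q - 1) j) - \<gamma> (q - 1) * (rho (\<gamma> q) * eR (q + 1) j)"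
    if "odd q" for q
    using two_blocks_left[of q 2] that e1[of q] e1[of "q - 2"] by (simp add: P_def)
  have "return_amp \<beta> (2 * k) j = P (evolve \<beta> (j + int k * 0) (2 * k) (eR 0)) j"
    using evolve_add[of \<beta> j "2 * k" "2 * k" "delta j"]
    by (simp add: return_amp_def P_def mult_2 add.assoc distrib_right mult.commute)
  also have "evolve \<beta> (j + int k * 0) (2 * k) (eR 0) =
     (\<lambda>i. ((rho (\<gamma> 0) * rho (\<gamma> 1)) * eR 2 i + (rho (\<gamma> 0) * cnj (\<gamma> 1)) * eL 1 i)
        + ((cnj (\<gamma> 0) * rho (\<gamma> (- 1))) * eL (- 1) i + (- cnj (\<gamma> 0) * \<gamma> (- 1)) * eR 0 i))"
    using two_blocks_right[of 0 0] by (simp add: algebra_simps)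
  also have "P \<dots> j = (rho (\<gamma> 0) * rho (\<gamma> 1)) * P (eR 2) j + (rho (\<gamma> 0) * cnj (\<gamma> 1)) * P (eL 1) j
        + ((cnj (\<gamma> 0) * rho (\<gamma> (- 1))) * P (eL (- 1)) j + (- cnj (\<gamma> 0) * \<gamma> (- 1)) * P (eR 0) j)"
    by (simp only: P_add P_scale)
  also have "P (eR 2) j = 0" using R[of 2] by (simp only: e0) simp
  also have "P (eL 1) j = - rho (\<gamma> 0) * \<gamma> (- 1)" using L[of 1] by (simp only: e0) simp
  also have "P (eL (- 1)) j = - \<gamma> (- 2) * rho (\<gamma> (- 1))" using L[of "- 1"] by (simp only: e0) simp
  also have "P (eR 0) j = - cnj (\<gamma> 0) * \<gamma> (- 1)" using R[of 0] by (simp only: e0) simp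
  finally show ?thesis by (simp add: power2_eq_square algebra_simps)
qed

text \<open>The relations between neighbours express all \<open>\<gamma>\<close> involved by
  \<open>\<beta> j\<close> and \<open>c\<close>, and then \<open>\<beta> j\<close> survives only
  through its modulus. Each of the three summands of \<open>return_amp_expand\<close> contributes
  one \<open>c\<^sup>2\<close>.\<close>

lemma return_amp_sieved:
  assumes "\<And>n. cmod (\<beta> n) \<le> 1"
  shows "return_amp \<beta> (2 * k) j =
    3 * c\<^sup>2 - c / cnj c * of_real ((cmod (\<beta> j))\<^sup>2 + (cmod c)\<^sup>2 / (cmod (\<beta> j))\<^sup>2)"
proof -
  define g where "g = \<beta> j"
  have g: "g \<noteq> 0" "\<gamma> 0 = g" using \<gamma>_nz[of 0] by (simp_all add: g_def)
  have g1: "\<gamma> 1 = - cnj c / cnj g" using \<gamma>_up[of 0] by (simp add: g_def)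
  have gm1: "\<gamma> (- 1) = - c / cnj g" using \<gamma>_down[of 0] by (simp add: g_def)
  have gm2: "\<gamma> (- 2) = c * g / cnj c" using \<gamma>_down[of "- 1"] unfolding gm1 by simp
  have r: "(rho (\<gamma> q))\<^sup>2 = 1 - \<gamma> q * cnj (\<gamma> q)" for q
    unfolding power2_eq_square by (rule rho_mult_rho[OF assms])
  have r0: "(rho (\<gamma> 0))\<^sup>2 = 1 - g * cnj g" using r[of 0] unfolding g(2) .
  have rm1: "(rho (\<gamma> (- 1)))\<^sup>2 = 1 - (c / cnj g) * (cnj c / g)" using r[of "- 1"] unfolding gm1 by simp
  have "return_amp \<beta> (2 * k) j = (cnj g)\<^sup>2 * (c / cnj g)\<^sup>2
     - cnj g * (c * g / cnj c) * (1 - (c / cnj g) * (cnj c / g)) - (1 - g * cnj g) * (c / g) * (c / cnj g)"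
    unfolding return_amp_expand r0 rm1 unfolding g(2) g1 gm1 gm2 by simp
  also have "\<dots> = 3 * c\<^sup>2 - c / cnj c * (g * cnj g + c * cnj c / (g * cnj g))"
  proof -
    have "(cnj g)\<^sup>2 * (c / cnj g)\<^sup>2 = c\<^sup>2" using g(1) by (simp flip: power_mult_distrib)
    moreover have "cnj g * (c * g / cnj c) * (1 - (c / cnj g) * (cnj c / g)) = c / cnj c * (g * cnj g) - c\<^sup>2"
      using g(1) c by (simp add: right_diff_distrib power2_eq_square)
    moreover have "(1 - g * cnj g) * (c / g) * (c / cnj g) = c / cnj c * (c * cnj c / (g * cnj g)) - c\<^sup>2"
      using g(1) c by (simp add: left_diff_distrib diff_divide_distrib power2_eq_square)
    ultimately show ?thesis by (simp add: algebra_simps)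
  qed
  finally show ?thesis by (simp only: g_def of_real_add of_real_divide complex_norm_square)
qed

end

section \<open>Independence of the site, and uniqueness up to shift and phase\<close>

lemma return_amp_sieved_const:
  assumes "sieved \<beta> j k c" "k \<ge> 1" "c \<noteq> 0"
  shows "return_amp \<beta> l n = return_amp \<beta> l 0"
proof -
  \<comment> \<open>On the progression the reflection symmetry about bond \<open>n\<close> applies
    after recentring; off it the bond is transparent.\<close>
  have step: "return_amp \<beta> l (n + 1) = return_amp \<beta> l n" for n
  proof (cases "int k dvd n - j")
    case True
    then obtain q where "n = j + int k * q" by (metis add.commute diff_add_cancel dvdE)
    then show ?thesis
      using sieved_return_amp_step[OF sieved_recentre[OF assms] assms(2,3)] by simp
  next
    case False
    then show ?thesis using assms(1) by (intro return_amp_zero) (auto simp: sieved_def)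
  qed
  show ?thesis
  proof (induction n rule: int_induct[of _ 0])
    case (step2 i)
    then show ?case using step[of "i - 1"] by simp
  qed (simp_all add: step)
qed

text \<open>The relation between neighbours determines the sequence from one nonzero value and
  survives multiplication by a unimodular constant, so it suffices to match moduli at one
  point.\<close>

lemma sieved_phase:
  assumes "sieved \<beta> j k c" "sieved \<beta>' j' k c" "k \<ge> 1" "c \<noteq> 0" "cmod (\<beta> j) = cmod (\<beta>' j')"
  shows "\<exists>\<phi>. \<forall>n. \<beta>' n = cis \<phi> * \<beta> (n + (j - j'))"
proof -
  define u where "u = \<beta>' j' / \<beta> j"
  have nz: "\<beta> (j + int k * q) \<noteq> 0" "\<beta>' (j' + int k * q) \<noteq> 0" for q
    using sieved_nonzero assms by blast+
  have j: "\<beta> j \<noteq> 0" "\<beta>' j' \<noteq> 0" using nz[of 0] by simp_all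
  have "cmod u = 1" using assms(5) j by (simp add: u_def norm_divide)
  then have u: "u * cnj u = 1" "u \<noteq> 0" by (auto simp flip: complex_norm_square)
  obtain \<phi> where \<phi>: "u = cis \<phi>"
    using \<open>cmod u = 1\<close> by (metis cis_Arg norm_eq_zero sgn_div_norm scaleR_one inverse_1 zero_neq_one)
  have on: "\<beta>' (j' + int k * q) = u * \<beta> (j + int k * q)" for q
  proof (induction q rule: int_induct[of _ 0])
    case base
    show ?case using j by (simp add: u_def)
  next
    case (step1 q)
    have "\<beta>' (j' + int k * q) * cnj (\<beta>' (j' + int k * (q + 1))) = - c"
      "\<beta> (j + int k * q) * cnj (\<beta> (j + int k * (q + 1))) = - c"
      using assms(1,2) unfolding sieved_def by blast+
    then have "\<beta> (j + int k * q) * (u * cnj (\<beta>' (j' + int k * (q + 1)))) =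
        \<beta> (j + int k * q) * cnj (\<beta> (j + int k * (q + 1)))"
      unfolding step1(2) by (simp add: mult_ac)
    then have "u * cnj (\<beta>' (j' + int k * (q + 1))) = cnj (\<beta> (j + int k * (q + 1)))"
      using nz[of q] by simp
    then have "(u * cnj u) * \<beta>' (j' + int k * (q + 1)) = u * \<beta> (j + int k * (q + 1))"
      by (metis complex_cnj_cnj complex_cnj_mult mult.assoc)
    then show ?case unfolding u by simp
  next
    case (step2 q)
    have "\<beta>' (j' + int k * (q - 1)) * cnj (\<beta>' (j' + int k * q)) = - c"
      "\<beta> (j + int k * (q - 1)) * cnj (\<beta> (j + int k * q)) = - c"
      using assms(1,2) unfolding sieved_def by (metis diff_add_cancel)+
    then have "cnj (\<beta> (j + int k * q)) * (cnj u * \<beta>' (j' + int k * (q - 1))) =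
        cnj (\<beta> (j + int k * q)) * \<beta> (j + int k * (q - 1))"
      unfolding step2(2) by (simp add: mult_ac)
    then have "cnj u * \<beta>' (j' + int k * (q - 1)) = \<beta> (j + int k * (q - 1))"
      using nz[of q] by simp
    then have "(u * cnj u) * \<beta>' (j' + int k * (q - 1)) = u * \<beta> (j + int k * (q - 1))"
      by (metis mult.assoc)
    then show ?case unfolding u by simp
  qed
  have "\<beta>' n = u * \<beta> (n + (j - j'))" for n
  proof (cases "int k dvd n - j'")
    case True
    then obtain q where "n = j' + int k * q" by (metis add.commute diff_add_cancel dvdE)
    then show ?thesis using on[of q] by (simp add: algebra_simps)
  next
    case False
    then have "\<beta>' n = 0" "\<beta> (n + (j - j')) = 0"
      using assms(1,2) by (simp_all add: sieved_def)
    then show ?thesis by simp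
  qed
  then show ?thesis using \<phi> by blast
qed

text \<open>The amplitude after \<open>2 * k\<close> steps yields
  \<open>r\<^sup>2 + (cmod c)\<^sup>2 / r\<^sup>2\<close>, which determines \<open>r\<close> up to
  exchange with \<open>cmod c / r\<close>. The latter is the modulus of the next nonzero
  coefficient, so a shift by \<open>k\<close> undoes the exchange.\<close>

lemma sieved_unique:
  assumes "sieved \<beta> j k c" "sieved \<beta>' j' k c" "k \<ge> 1" "c \<noteq> 0"
    and "\<And>n. cmod (\<beta> n) \<le> 1" "\<And>n. cmod (\<beta>' n) \<le> 1"
    and "\<And>n. return_amp \<beta> (2 * k) n = d" "\<And>n. return_amp \<beta>' (2 * k) n = d"
  shows "\<exists>\<phi> m. \<forall>n. \<beta>' n = cis \<phi> * \<beta> (n + m)"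
proof -
  define r s where "r = cmod (\<beta> j)" and "s = cmod (\<beta>' j')"
  have "\<beta> j \<noteq> 0" "\<beta>' j' \<noteq> 0"
    using sieved_nonzero[OF assms(1,4), of 0] sieved_nonzero[OF assms(2,4), of 0] by simp_all
  then have pos: "r > 0" "s > 0" by (simp_all add: r_def s_def)
  define A where "A t = c / cnj c * complex_of_real (t\<^sup>2 + (cmod c)\<^sup>2 / t\<^sup>2)" for t
  have "3 * c\<^sup>2 - A r = d" "3 * c\<^sup>2 - A s = d"
    using return_amp_sieved[OF assms(1,3-5)] return_amp_sieved[OF assms(2-4,6)] assms(7)[of j] assms(8)[of j']
    unfolding r_def s_def A_def by metis+
  then have "A r = A s" by (metis minus_diff_eq add_diff_cancel_left' diff_add_cancel uminus_add_conv_diff)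
  then have "(of_real (r\<^sup>2 + (cmod c)\<^sup>2 / r\<^sup>2) :: complex) = of_real (s\<^sup>2 + (cmod c)\<^sup>2 / s\<^sup>2)"
    using assms(4) unfolding A_def by (metis mult_left_cancel divide_eq_0_iff complex_cnj_zero_iff)
  then have "r\<^sup>2 + (cmod c)\<^sup>2 / r\<^sup>2 = s\<^sup>2 + (cmod c)\<^sup>2 / s\<^sup>2" by (simp only: of_real_eq_iff)
  then have "(r\<^sup>2 - s\<^sup>2) * ((r * s)\<^sup>2 - (cmod c)\<^sup>2) = 0"
    using pos by (simp add: field_simps power2_eq_square)
  then have "r = s \<or> r * s = cmod c"
    using pos by (auto simp: power2_eq_iff_nonneg)
  then show ?thesis
  proof
    assume "r = s"
    then show ?thesis using sieved_phase[OF assms(1-4)] by (auto simp: r_def s_def)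
  next
    assume rs: "r * s = cmod c"
    have "\<beta> j * cnj (\<beta> (j + int k)) = - c"
      using assms(1)[unfolded sieved_def, THEN conjunct1, rule_format, of 0] by simp
    then have "r * cmod (\<beta> (j + int k)) = cmod c"
      unfolding r_def by (metis norm_mult complex_mod_cnj norm_minus_cancel)
    then have "cmod (\<beta> (j + int k)) = s" using rs pos by (metis mult_cancel_left less_irrefl)
    then show ?thesis
      using sieved_phase[OF sieved_recentre[OF assms(1,3,4), of 1] assms(2-4)] by (auto simp: s_def)
  qed
qed

section \<open>CMV matrices in terms of half steps\<close>

lemma matrix_operator_finite:
  assumes "finite S" "\<And>j. j \<notin> S \<Longrightarrow> A i j = 0"
  shows "matrix_operator A f i = (\<Sum>j\<in>S. A i j * f j)"
proof -
  have "matrix_operator A f i = infsum (\<lambda>j. A i j * f j) S"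
    unfolding matrix_operator_def by (rule infsum_cong_neutral) (auto simp: assms(2))
  then show ?thesis using assms(1) by simp
qed

section \<open>Whole-line matrices as walks\<close>

lemma whole_L_half_step: "matrix_operator (whole_L \<beta>) = half_step \<beta> 0"
proof (intro ext)
  fix f i
  show "matrix_operator (whole_L \<beta>) f i = half_step \<beta> 0 f i"
  proof (cases "even i")
    case True
    then have "whole_L \<beta> i j = 0" if "j \<notin> {i, i + 1}" for j
      using that unfolding whole_L_def by (auto; presburger)
    then have "matrix_operator (whole_L \<beta>) f i = (\<Sum>j\<in>{i, i + 1}. whole_L \<beta> i j * f j)"
      by (intro matrix_operator_finite) auto
    then show ?thesis using True by (simp add: whole_L_def half_step_def)
  next
    case False
    then have "whole_L \<beta> i j = 0" if "j \<notin> {i - 1, i}" for j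
      using that unfolding whole_L_def by (auto; presburger)
    then have "matrix_operator (whole_L \<beta>) f i = (\<Sum>j\<in>{i - 1, i}. whole_L \<beta> i j * f j)"
      by (intro matrix_operator_finite) auto
    moreover have "(i - 1) div 2 = i div 2" "2 * (i div 2) = i - 1" using False by presburger+
    ultimately show ?thesis using False by (simp add: whole_L_def half_step_def)
  qed
qed

lemma whole_M_half_step: "matrix_operator (whole_M \<beta>) = half_step \<beta> 1"
proof (intro ext)
  fix f i
  show "matrix_operator (whole_M \<beta>) f i = half_step \<beta> 1 f i"
  proof (cases "odd i")
    case True
    then have "whole_M \<beta> i j = 0" if "j \<notin> {i, i + 1}" for j
      using that unfolding whole_M_def by (auto; presburger)
    then have "matrix_operator (whole_M \<beta>) f i = (\<Sum>j\<in>{i, i + 1}. whole_M \<beta> i j * f j)"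
      by (intro matrix_operator_finite) auto
    moreover have "(i + 1 + 1) div 2 = (i + 1) div 2" "2 * ((i + 1) div 2) = i + 1" using True by presburger+
    ultimately show ?thesis using True by (simp add: whole_M_def half_step_def)
  next
    case False
    then have "whole_M \<beta> i j = 0" if "j \<notin> {i - 1, i}" for j
      using that unfolding whole_M_def by (auto; presburger)
    then have "matrix_operator (whole_M \<beta>) f i = (\<Sum>j\<in>{i - 1, i}. whole_M \<beta> i j * f j)"
      by (intro matrix_operator_finite) auto
    moreover have "(i + 1) div 2 = i div 2" "2 * (i div 2) = i" using False by presburger+
    ultimately show ?thesis using False by (simp add: whole_M_def half_step_def)
  qed
qed

lemma whole_line_CMV_power: "(whole_line_CMV \<beta> ^^ l) f = evolve \<beta> 1 (2 * l) f"
proof (induction l)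
  case (Suc l)
  have "half_step \<beta> (1 + int (2 * l)) = half_step \<beta> 1" "half_step \<beta> (1 + int (Suc (2 * l))) = half_step \<beta> 0"
    by (rule half_step_parity; simp)+
  then show ?case
    using Suc by (simp add: whole_line_CMV_def whole_L_half_step whole_M_half_step)
qed simp

lemma l2_inner_delta: "l2_inner (delta n) g = g n"
proof -
  have "l2_inner (delta n) g = infsum (\<lambda>i. cnj (delta n i) * g i) {n}"
    unfolding l2_inner_def by (rule infsum_cong_neutral) (auto simp: delta_def)
  then show ?thesis by (simp add: delta_def)
qed

text \<open>\<open>M\<close> acts first, hence the start index 1. For even \<open>n\<close> it
  leaves \<open>n\<close> across the left bond, which is where transposition enters.\<close>

lemma evolve_return_amp: "evolve \<beta> 1 (2 * l) (delta n) n = return_amp \<beta> l n"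
proof (cases "even n")
  case True
  have "evolve \<beta> 1 (2 * l) (delta n) = evolve \<beta> (n + 1) (2 * l) (delta n)"
    by (rule fun_cong[OF evolve_parity]) (use True in simp)
  then show ?thesis by (simp only: return_amp_transpose)
next
  case False
  have "evolve \<beta> 1 (2 * l) (delta n) = evolve \<beta> n (2 * l) (delta n)"
    by (rule fun_cong[OF evolve_parity]) (use False in simp)
  then show ?thesis by (simp only: return_amp_def)
qed

lemma whole_line_CMV_return_amp:
  "l2_inner (delta n) ((whole_line_CMV \<beta> ^^ l) (delta n)) = return_amp \<beta> l n"
  by (simp add: l2_inner_delta whole_line_CMV_power evolve_return_amp)

text \<open>The coefficient \<open>- 1\<close> at \<open>- 1\<close> has \<open>\<rho> = 0\<close>, so extending \<open>\<alpha>\<close> by \<open>- 1\<close> decouples the half line and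
  produces the entry \<open>1\<close> of \<open>M\<close> at \<open>0\<close>.\<close>

definition extend :: "'a \<Rightarrow> (nat \<Rightarrow> 'a) \<Rightarrow> int \<Rightarrow> 'a" where
  "extend a f i = (if i < 0 then a else f (nat i))"

lemma extend_of_nat [simp]: "extend a f (int n) = f n"
  by (simp add: extend_def)

lemma extend_of_nat_add [simp]: "extend a f (int n + 1) = f (n + 1)"
  by (simp add: extend_def nat_add_distrib)

lemma extend_of_nat_diff [simp]: "n > 0 \<Longrightarrow> extend a f (int n - 1) = f (n - 1)"
  by (simp add: extend_def nat_diff_distrib)

section \<open>Half-line matrices as walks with a wall at the left end\<close>

lemma half_L_row:
  "matrix_operator (half_L \<alpha>) f n = (if even n then cnj (\<alpha> n) * f n + rho (\<alpha> n) * f (n + 1)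
     else rho (\<alpha> (n - 1)) * f (n - 1) - \<alpha> (n - 1) * f n)"
proof (cases "even n")
  case True
  then have "half_L \<alpha> n j = 0" if "j \<notin> {n, n + 1}" for j
    using that unfolding half_L_def by (auto; presburger)
  then have "matrix_operator (half_L \<alpha>) f n = (\<Sum>j\<in>{n, n + 1}. half_L \<alpha> n j * f j)"
    by (intro matrix_operator_finite) auto
  then show ?thesis using True by (simp add: half_L_def)
next
  case False
  then have "half_L \<alpha> n j = 0" if "j \<notin> {n - 1, n}" for j
    using that unfolding half_L_def by (auto; presburger)
  then have "matrix_operator (half_L \<alpha>) f n = (\<Sum>j\<in>{n - 1, n}. half_L \<alpha> n j * f j)"
    by (intro matrix_operator_finite) auto
  moreover have "(n - 1) div 2 = n div 2" "2 * (n div 2) = n - 1" "n - 1 \<noteq> n" "even (n - 1)"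
    using False by presburger+
  ultimately show ?thesis using False by (simp add: half_L_def)
qed

lemma half_M_row:
  "matrix_operator (half_M \<alpha>) f n = (if n = 0 then f 0
     else if odd n then cnj (\<alpha> n) * f n + rho (\<alpha> n) * f (n + 1)
     else rho (\<alpha> (n - 1)) * f (n - 1) - \<alpha> (n - 1) * f n)"
proof -
  consider "n = 0" | "odd n" | "even n" "n > 0" by auto
  then show ?thesis
  proof cases
    case 1
    have "matrix_operator (half_M \<alpha>) f 0 = (\<Sum>j\<in>{0}. half_M \<alpha> 0 j * f j)"
      by (intro matrix_operator_finite) (auto simp: half_M_def)
    then show ?thesis using 1 by (simp add: half_M_def)
  next
    case 2
    then have "half_M \<alpha> n j = 0" if "j \<notin> {n, n + 1}" for j
      using that unfolding half_M_def by (auto; presburger)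
    then have "matrix_operator (half_M \<alpha>) f n = (\<Sum>j\<in>{n, n + 1}. half_M \<alpha> n j * f j)"
      by (intro matrix_operator_finite) auto
    moreover have "(n + 1 + 1) div 2 = (n + 1) div 2" "2 * ((n + 1) div 2) = n + 1" "n \<noteq> 0"
      using 2 by presburger+
    ultimately show ?thesis using 2 by (simp add: half_M_def)
  next
    case 3
    then have "half_M \<alpha> n j = 0" if "j \<notin> {n - 1, n}" for j
      using that unfolding half_M_def by (auto; presburger)
    then have "matrix_operator (half_M \<alpha>) f n = (\<Sum>j\<in>{n - 1, n}. half_M \<alpha> n j * f j)"
      by (intro matrix_operator_finite) auto
    moreover have "(n + 1) div 2 = n div 2" "2 * (n div 2) = n" "n - 1 \<noteq> n" "odd (n - 1)" "n - 1 + 1 = n"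
      using 3 by presburger+
    ultimately show ?thesis using 3 by (simp add: half_M_def)
  qed
qed

lemma half_L_half_step:
  "extend 0 (matrix_operator (half_L \<alpha>) f) = half_step (extend (- 1) \<alpha>) 0 (extend 0 f)"
proof
  fix i
  show "extend 0 (matrix_operator (half_L \<alpha>) f) i = half_step (extend (- 1) \<alpha>) 0 (extend 0 f) i"
  proof (cases "i < 0")
    case True
    \<comment> \<open>\<open>L\<close> has no bond between -1 and 0: for even negative
      \<open>i\<close>, also \<open>i + 1\<close> is negative, so the padding by zeros
      persists.\<close>
    then show ?thesis by (auto simp: extend_def half_step_def elim!: evenE)
  next
    case False
    then obtain n where n: "i = int n" by (metis nonneg_int_cases not_less)
    then show ?thesis
      unfolding n half_step_def extend_of_nat half_L_row by (simp add: odd_pos)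
  qed
qed

lemma half_M_half_step:
  "extend 0 (matrix_operator (half_M \<alpha>) f) = half_step (extend (- 1) \<alpha>) 1 (extend 0 f)"
proof
  fix i
  have [simp]: "rho (- 1) = 0" by (simp add: rho_def)
  show "extend 0 (matrix_operator (half_M \<alpha>) f) i = half_step (extend (- 1) \<alpha>) 1 (extend 0 f) i"
  proof (cases "i \<le> 0")
    case True
    \<comment> \<open>Bond -1 reflects everything; seen from 0 its amplitude is
      \<open>- (- 1)\<close>, the exceptional entry of \<open>M\<close>.\<close>
    then show ?thesis by (auto simp: extend_def half_step_def half_M_row)
  next
    case False
    then obtain n where n: "i = int n" by (metis nonneg_int_cases linear)
    have "n > 0" using False n by simp
    then show ?thesis
      unfolding n half_step_def extend_of_nat half_M_row by simp
  qed
qed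

lemma half_line_CMV_power:
  "extend 0 ((half_line_CMV \<alpha> ^^ l) f) = evolve (extend (- 1) \<alpha>) 1 (2 * l) (extend 0 f)"
proof (induction l)
  case (Suc l)
  have "half_step \<beta> (1 + int (2 * l)) = half_step \<beta> 1" "half_step \<beta> (1 + int (Suc (2 * l))) = half_step \<beta> 0"
    for \<beta> by (rule half_step_parity; simp)+
  then show ?case
    using Suc by (simp add: half_line_CMV_def half_L_half_step half_M_half_step)
qed simp

lemma half_line_CMV_return_amp:
  "l2_inner (delta n) ((half_line_CMV \<alpha> ^^ l) (delta n)) = return_amp (extend (- 1) \<alpha>) l (int n)"
proof -
  have "extend 0 (delta n) = delta (int n)" by (auto simp: extend_def delta_def fun_eq_iff)
  then have "extend 0 ((half_line_CMV \<alpha> ^^ l) (delta n)) (int n)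
      = evolve (extend (- 1) \<alpha>) 1 (2 * l) (delta (int n)) (int n)"
    by (simp only: half_line_CMV_power)
  then show ?thesis by (simp add: l2_inner_delta evolve_return_amp)
qed

section \<open>Orthogonal polynomials of a half-line CMV matrix\<close>

lemma cnj_mult_unit: "cmod z = 1 \<Longrightarrow> cnj z * z = 1"
  by (subst mult.commute) (simp flip: complex_norm_square)

lemma cnj_power_mult_unit: "cmod z = 1 \<Longrightarrow> cnj z ^ n * z ^ n = 1"
  by (simp add: cnj_mult_unit flip: power_mult_distrib)

lemma circle_measure_space: "circle_measure \<mu> \<Longrightarrow> space \<mu> = unit_circle"
  unfolding circle_measure_def by (metis sets_eq_imp_space_eq space_restrict_space space_borel Int_UNIV_right)

lemma circle_measure_measurable:
  assumes "circle_measure \<mu>" "continuous_on unit_circle f"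
  shows "f \<in> borel_measurable \<mu>"
proof -
  have "f \<in> borel_measurable (restrict_space borel unit_circle)"
    using assms(2) by (rule borel_measurable_continuous_on_restrict)
  then show ?thesis
    using assms(1) measurable_cong_sets[of \<mu> "restrict_space borel unit_circle"]
    by (auto simp: circle_measure_def)
qed

lemma circle_measure_integrable:
  fixes f :: "complex \<Rightarrow> 'b :: {banach, second_countable_topology}"
  assumes "circle_measure \<mu>" "continuous_on unit_circle f"
  shows "integrable \<mu> f"
proof -
  interpret finite_measure \<mu> using assms(1) by (simp add: circle_measure_def)
  have "compact (f ` unit_circle)"
    using assms(2) by (intro compact_continuous_image) (auto simp: unit_circle_def)
  then have "bounded (f ` unit_circle)" by (rule compact_imp_bounded)
  then obtain B where "\<And>z. z \<in> unit_circle \<Longrightarrow> norm (f z) \<le> B"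
    by (auto simp: bounded_iff)
  then show ?thesis
    using circle_measure_measurable[OF assms] circle_measure_space[OF assms(1)]
    by (intro integrable_const_bound[of _ B]) auto
qed

lemma circle_integral_cong:
  assumes "circle_measure \<mu>" "\<And>z. cmod z = 1 \<Longrightarrow> f z = g z"
  shows "integral\<^sup>L \<mu> f = integral\<^sup>L \<mu> g"
  using assms circle_measure_space[OF assms(1)]
  by (intro Bochner_Integration.integral_cong) (auto simp: unit_circle_def)

section \<open>Szego recursion for the orthonormal polynomials and their reversals\<close>

primrec szego :: "(nat \<Rightarrow> complex) \<Rightarrow> nat \<Rightarrow> complex poly \<times> complex poly" where
  "szego \<alpha> 0 = (1, 1)"
| "szego \<alpha> (Suc n) = (let (p, q) = szego \<alpha> n in
     (smult (1 / rho (\<alpha> n)) (pCons 0 p) + smult (- cnj (\<alpha> n) / rho (\<alpha> n)) q,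
      smult (1 / rho (\<alpha> n)) q + smult (- \<alpha> n / rho (\<alpha> n)) (pCons 0 p)))"

abbreviation "szego_phi \<alpha> n \<equiv> fst (szego \<alpha> n)"
abbreviation "szego_rev \<alpha> n \<equiv> snd (szego \<alpha> n)"

lemma szego_Suc:
  "szego_phi \<alpha> (Suc n) = smult (1 / rho (\<alpha> n)) (pCons 0 (szego_phi \<alpha> n))
     + smult (- cnj (\<alpha> n) / rho (\<alpha> n)) (szego_rev \<alpha> n)"
  "szego_rev \<alpha> (Suc n) = smult (1 / rho (\<alpha> n)) (szego_rev \<alpha> n)
     + smult (- \<alpha> n / rho (\<alpha> n)) (pCons 0 (szego_phi \<alpha> n))"
  by (simp_all add: case_prod_unfold Let_def)

declare szego.simps(2) [simp del]

lemma szego_rev_circle: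
  assumes "cmod z = 1"
  shows "poly (szego_rev \<alpha> n) z = z ^ n * cnj (poly (szego_phi \<alpha> n) z)"
proof (induction n)
  case (Suc n)
  have z: "z * cnj z = 1" using assms by (simp flip: complex_norm_square)
  then have "z ^ n * cnj z ^ n = 1" by (metis power_mult_distrib power_one)
  then have 1: "z ^ n * (cnj z ^ n * x) = x" for x by (metis mult.assoc mult_1)
  have 2: "z * (cnj z * x) = x" for x using z by (metis mult.assoc mult_1)
  show ?case
    by (simp add: szego_Suc Suc algebra_simps 1 2)
qed simp

text \<open>The leading coefficient of \<open>szego_phi \<alpha> n\<close>, hence the reciprocal of
  the norm of the monic orthogonal polynomial.\<close>

definition szego_norm :: "(nat \<Rightarrow> complex) \<Rightarrow> nat \<Rightarrow> real" where
  "szego_norm \<alpha> n = (\<Prod>i<n. 1 / sqrt (1 - (cmod (\<alpha> i))\<^sup>2))"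

lemma szego_degree:
  "degree (szego_phi \<alpha> n) \<le> n \<and> degree (szego_rev \<alpha> n) \<le> n \<and>
     coeff (szego_phi \<alpha> n) n = of_real (szego_norm \<alpha> n)"
proof (induction n)
  case (Suc n)
  have "degree (pCons 0 (szego_phi \<alpha> n)) \<le> Suc n" "degree (szego_rev \<alpha> n) \<le> Suc n"
    using Suc degree_pCons_le[of 0 "szego_phi \<alpha> n"] by linarith+
  moreover have "coeff (szego_rev \<alpha> n) (Suc n) = 0"
    using Suc by (intro coeff_eq_0) linarith
  ultimately show ?case
    using Suc
    by (intro conjI; unfold szego_Suc; (intro degree_add_le order.trans[OF degree_smult_le])?)
      (simp_all add: szego_norm_def rho_def)
qed (simp add: szego_norm_def)

text \<open>\<open>v = p(E) \<delta>\<^sub>0\<close>, the vector of \<open>p\<close> under the spectral isometry.\<close>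

inductive represents :: "(int \<Rightarrow> complex) \<Rightarrow> complex poly \<Rightarrow> (int \<Rightarrow> complex) \<Rightarrow> bool" for \<beta> where
  one: "represents \<beta> 1 (delta 0)"
| shift: "represents \<beta> p v \<Longrightarrow> represents \<beta> (pCons 0 p) (evolve \<beta> 1 2 v)"
| lin: "represents \<beta> p v \<Longrightarrow> represents \<beta> q w \<Longrightarrow>
    represents \<beta> (smult a p + smult b q) (\<lambda>i. a * v i + b * w i)"

lemma represents_fin_supp: "represents \<beta> p v \<Longrightarrow> fin_supp v"
  by (induction rule: represents.induct) (simp_all add: fin_supp_evolve fin_supp_lin)

lemma CMV_power_add: "evolve \<beta> 1 (2 * (l + m)) f = evolve \<beta> 1 (2 * l) (evolve \<beta> 1 (2 * m) f)"
proof -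
  have "evolve \<beta> 1 (2 * m + 2 * l) f = evolve \<beta> (1 + int (2 * m)) (2 * l) (evolve \<beta> 1 (2 * m) f)"
    by (rule evolve_add)
  also have "evolve \<beta> (1 + int (2 * m)) (2 * l) = evolve \<beta> 1 (2 * l)"
    by (rule evolve_parity) simp
  finally show ?thesis by (simp only: distrib_left add.commute)
qed

lemma evolve_support:
  assumes "\<And>i. i < a \<Longrightarrow> f i = 0" "i < a - int h"
  shows "evolve \<beta> s h f i = 0"
  using assms(2) by (induction h arbitrary: i) (simp_all add: half_step_def assms(1))

lemma sesq_lin_right:
  "fin_supp f \<Longrightarrow> sesq f (\<lambda>i. a * g i + b * h i) = a * sesq f g + b * sesq f h"
  by (rule pairing_lin_right) simp

lemma sesq_lin_left:
  "fin_supp f \<Longrightarrow> sesq (\<lambda>i. a * g i + b * h i) f = cnj a * sesq g f + cnj b * sesq h f"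
  using pairing_lin_right[of f "cnj a" "\<lambda>i. cnj (g i)" "cnj b" "\<lambda>i. cnj (h i)"]
  by (simp add: pairing_commute[of f])

section \<open>Spectral isometry of a half-line CMV matrix\<close>

locale half_line =
  fixes \<alpha> :: "nat \<Rightarrow> complex" and \<mu> :: "complex measure"
  assumes \<alpha>: "cmod (\<alpha> n) < 1"
    and spectral: "is_spectral_measure (half_line_CMV \<alpha>) (delta 0) \<mu>"
begin

abbreviation \<beta> :: "int \<Rightarrow> complex" where "\<beta> \<equiv> extend (- 1) \<alpha>"
abbreviation "power_vec l v \<equiv> evolve \<beta> 1 (2 * l) v"

lemma \<beta>_le: "cmod (\<beta> n) \<le> 1"
  using \<alpha>[of "nat n"] by (simp add: extend_def less_imp_le)

lemma \<rho>_nz: "rho (\<alpha> n) \<noteq> 0"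
proof -
  have "(cmod (\<alpha> n))\<^sup>2 < 1" using \<alpha>[of n] by (simp add: abs_square_less_1)
  then show ?thesis by (simp add: rho_def)
qed

lemma circle: "circle_measure \<mu>"
  using spectral by (simp add: is_spectral_measure_def)

lemma moments: "integral\<^sup>L \<mu> (\<lambda>z. z ^ l) = power_vec l (delta 0) 0"
  using spectral half_line_CMV_return_amp[where n = 0 and \<alpha> = \<alpha> and l = l]
  by (simp add: is_spectral_measure_def evolve_return_amp)

lemma int_cont [simp, intro]: "continuous_on unit_circle f \<Longrightarrow> integrable \<mu> (f :: complex \<Rightarrow> complex)"
  by (rule circle_measure_integrable[OF circle])

lemma sesq_power: "fin_supp v \<Longrightarrow> sesq (power_vec l v) (power_vec l w) = sesq v w"
  by (rule sesq_evolve[OF \<beta>_le])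

text \<open>On the circle only the difference of the exponents matters, and unitarity strips the
  common powers from both vectors; what remains is a moment or its conjugate.\<close>

lemma monomials: "integral\<^sup>L \<mu> (\<lambda>z. cnj (z ^ m) * z ^ j) = sesq (power_vec m (delta 0)) (power_vec j (delta 0))"
proof (cases "m \<le> j")
  case True
  then obtain d where d: "j = m + d" by (metis le_Suc_ex)
  have "integral\<^sup>L \<mu> (\<lambda>z. cnj (z ^ m) * z ^ j) = integral\<^sup>L \<mu> (\<lambda>z. z ^ d)"
    by (intro circle_integral_cong[OF circle]) (auto simp: d power_add cnj_power_mult_unit simp flip: mult.assoc)
  moreover have "sesq (power_vec m (delta 0)) (power_vec j (delta 0)) = sesq (delta 0) (power_vec d (delta 0))"
    unfolding d CMV_power_add by (rule sesq_power) simp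
  moreover have "(\<lambda>i. cnj (delta 0 i)) = delta (0 :: int)" by (auto simp: delta_def)
  ultimately show ?thesis by (simp add: moments)
next
  case False
  then obtain d where d: "m = j + d" by (metis le_Suc_ex nat_le_linear)
  have "integral\<^sup>L \<mu> (\<lambda>z. cnj (z ^ m) * z ^ j) = integral\<^sup>L \<mu> (\<lambda>z. cnj (z ^ d))"
    by (intro circle_integral_cong[OF circle]) (auto simp: d power_add mult.assoc mult.left_commute[of "cnj z ^ d" for z] cnj_power_mult_unit)
  also have "\<dots> = cnj (power_vec d (delta 0) 0)" by (simp only: Bochner_Integration.integral_cnj moments)
  moreover have "sesq (power_vec m (delta 0)) (power_vec j (delta 0)) = sesq (power_vec d (delta 0)) (delta 0)"
    unfolding d CMV_power_add by (rule sesq_power) (simp add: fin_supp_evolve)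
  ultimately show ?thesis by (simp add: pairing_commute[of _ "delta 0"])
qed

text \<open>The free power \<open>z ^ j\<close> carries the induction: the rule \<open>shift\<close>
  raises it by one.\<close>

lemma represents_monomial:
  "represents \<beta> p v \<Longrightarrow>
     integral\<^sup>L \<mu> (\<lambda>z. cnj (z ^ m) * (z ^ j * poly p z)) = sesq (power_vec m (delta 0)) (power_vec j v)"
proof (induction arbitrary: j rule: represents.induct)
  case one
  show ?case using monomials by simp
next
  case (shift p v)
  have "power_vec j (evolve \<beta> 1 2 v) = power_vec (j + 1) v"
    using CMV_power_add[of \<beta> j 1 v] by simp
  then show ?case using shift.IH[of "j + 1"] by (simp add: mult_ac)
next
  case (lin p v q w a b)
  have "integral\<^sup>L \<mu> (\<lambda>z. cnj (z ^ m) * (z ^ j * poly (smult a p + smult b q) z)) =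
     integral\<^sup>L \<mu> (\<lambda>z. a * (cnj (z ^ m) * (z ^ j * poly p z)) + b * (cnj (z ^ m) * (z ^ j * poly q z)))"
    by (simp add: algebra_simps)
  also have "\<dots> = a * integral\<^sup>L \<mu> (\<lambda>z. cnj (z ^ m) * (z ^ j * poly p z))
      + b * integral\<^sup>L \<mu> (\<lambda>z. cnj (z ^ m) * (z ^ j * poly q z))"
    by (subst Bochner_Integration.integral_add) (auto intro!: continuous_intros)
  finally show ?case
    by (simp only: lin.IH evolve_lin sesq_lin_right[OF fin_supp_evolve[OF fin_supp_delta]])
qed

lemma represents_inner:
  assumes "represents \<beta> q w"
  shows "represents \<beta> p v \<Longrightarrow>
     integral\<^sup>L \<mu> (\<lambda>z. cnj (z ^ m * poly p z) * (z ^ j * poly q z)) = sesq (power_vec m v) (power_vec j w)"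
proof (induction arbitrary: m rule: represents.induct)
  case one
  show ?case using represents_monomial[OF assms] by simp
next
  case (shift p v)
  have "power_vec m (evolve \<beta> 1 2 v) = power_vec (m + 1) v"
    using CMV_power_add[of \<beta> m 1 v] by simp
  then show ?case using shift.IH[of "m + 1"] by (simp add: mult_ac)
next
  case (lin p v p' v' a b)
  let ?q = "\<lambda>z. z ^ j * poly q z"
  have "integral\<^sup>L \<mu> (\<lambda>z. cnj (z ^ m * poly (smult a p + smult b p') z) * ?q z) =
     integral\<^sup>L \<mu> (\<lambda>z. cnj a * (cnj (z ^ m * poly p z) * ?q z) + cnj b * (cnj (z ^ m * poly p' z) * ?q z))"
    by (simp add: algebra_simps)
  also have "\<dots> = cnj a * integral\<^sup>L \<mu> (\<lambda>z. cnj (z ^ m * poly p z) * ?q z)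
      + cnj b * integral\<^sup>L \<mu> (\<lambda>z. cnj (z ^ m * poly p' z) * ?q z)"
    by (subst Bochner_Integration.integral_add) (auto intro!: continuous_intros)
  finally show ?case
    by (simp only: lin.IH evolve_lin sesq_lin_left[OF fin_supp_evolve[OF represents_fin_supp[OF assms]]])
qed

text \<open>The half step across bond \<open>n\<close> is the Szego recursion. The map
  \<open>X\<close> sends \<open>delta n\<close> to the vector of
  \<open>szego_rev \<alpha> n\<close>; expanding the half step on \<open>delta n\<close> and
  \<open>delta (n + 1)\<close> and solving for the new vectors gives the two lines of the
  recursion.\<close>

lemma represents_szego:
  "represents \<beta> (szego_rev \<alpha> n) (evolve \<beta> (int n + 1) n (delta (int n))) \<and>
   represents \<beta> (pCons 0 (szego_phi \<alpha> n)) (evolve \<beta> (int n) (n + 1) (delta (int n))) \<and>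
   represents \<beta> (szego_phi \<alpha> n) (evolve \<beta> (int n) (n - 1) (delta (int n)))"
proof (induction n)
  case 0
  \<comment> \<open>The coefficient -1 at -1 makes \<open>M\<close> fix \<open>delta 0\<close>, so
    one half step and two half steps agree here; \<open>n - 1\<close> is truncated to 0.\<close>
  have [simp]: "rho (- 1) = 0" by (simp add: rho_def)
  have "evolve \<beta> 1 2 (delta 0) = half_step \<beta> 2 (half_step \<beta> 1 (delta 0))"
    by (simp add: numeral_2_eq_2)
  also have "half_step \<beta> 1 (delta 0) = delta 0"
    by (subst half_step_delta_left) (auto simp: extend_def)
  also have "half_step \<beta> 2 = half_step \<beta> 0"
    by (rule half_step_parity) simp
  finally show ?case
    using represents.one[of \<beta>] represents.shift[OF represents.one, of \<beta>] by simp
next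
  case (Suc n)
  define X where "X = evolve \<beta> (int n + 1) n"
  have X: "X (\<lambda>i. a * f i + b * g i) = (\<lambda>i. a * X f i + b * X g i)" for a b f g
    unfolding X_def by (rule evolve_lin)
  have r: "rho (\<alpha> n) * rho (\<alpha> n) = 1 - \<alpha> n * cnj (\<alpha> n)"
    using rho_mult_rho \<alpha> by (simp add: less_imp_le)
  have \<rho>: "rho (\<alpha> n) \<noteq> 0" by (rule \<rho>_nz)
  have step: "evolve \<beta> (int n) (n + 1) f = X (half_step \<beta> (int n) f)" for f
    by (simp only: Suc_eq_plus1[symmetric] evolve_Suc_left X_def)
  have "half_step \<beta> (int n) (delta (int n)) =
      (\<lambda>i. cnj (\<alpha> n) * delta (int n) i + rho (\<alpha> n) * delta (int n + 1) i)"
    using half_step_delta_right[of "int n" "int n" \<beta>] by simp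
  then have 1: "evolve \<beta> (int n) (n + 1) (delta (int n)) =
      (\<lambda>i. cnj (\<alpha> n) * X (delta (int n)) i + rho (\<alpha> n) * X (delta (int n + 1)) i)"
    by (simp only: step X)
  have "half_step \<beta> (int n) (delta (int n + 1)) =
      (\<lambda>i. - \<alpha> n * delta (int n + 1) i + rho (\<alpha> n) * delta (int n) i)"
    using half_step_delta_left[of "int n + 1" "int n" \<beta>] by simp
  then have 2: "evolve \<beta> (int n) (n + 1) (delta (int n + 1)) =
      (\<lambda>i. - \<alpha> n * X (delta (int n + 1)) i + rho (\<alpha> n) * X (delta (int n)) i)"
    by (simp only: step X)
  have phi: "represents \<beta> (szego_phi \<alpha> (Suc n)) (X (delta (int n + 1)))"
  proof -
    have "represents \<beta> (szego_phi \<alpha> (Suc n))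
       (\<lambda>i. 1 / rho (\<alpha> n) * evolve \<beta> (int n) (n + 1) (delta (int n)) i
          + (- cnj (\<alpha> n) / rho (\<alpha> n)) * X (delta (int n)) i)"
      unfolding szego_Suc X_def using Suc by (intro represents.lin) auto
    also have "(\<lambda>i. 1 / rho (\<alpha> n) * evolve \<beta> (int n) (n + 1) (delta (int n)) i
          + (- cnj (\<alpha> n) / rho (\<alpha> n)) * X (delta (int n)) i) = X (delta (int n + 1))"
      unfolding 1 using \<rho> by (intro ext) (simp add: distrib_left)
    finally show ?thesis .
  qed
  have rev: "represents \<beta> (szego_rev \<alpha> (Suc n)) (evolve \<beta> (int n) (n + 1) (delta (int n + 1)))"
  proof -
    have "represents \<beta> (szego_rev \<alpha> (Suc n))
       (\<lambda>i. 1 / rho (\<alpha> n) * X (delta (int n)) i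
          + (- \<alpha> n / rho (\<alpha> n)) * evolve \<beta> (int n) (n + 1) (delta (int n)) i)"
      unfolding szego_Suc X_def using Suc by (intro represents.lin) auto
    also have "(\<lambda>i. 1 / rho (\<alpha> n) * X (delta (int n)) i
          + (- \<alpha> n / rho (\<alpha> n)) * evolve \<beta> (int n) (n + 1) (delta (int n)) i)
        = (\<lambda>i. - \<alpha> n * X (delta (int n + 1)) i + (1 - \<alpha> n * cnj (\<alpha> n)) / rho (\<alpha> n) * X (delta (int n)) i)"
      unfolding 1 using \<rho> by (intro ext) (simp add: distrib_left left_diff_distrib diff_divide_distrib)
    also have "\<dots> = evolve \<beta> (int n) (n + 1) (delta (int n + 1))"
      unfolding 2 r[symmetric] using \<rho> by (intro ext) simp
    finally show ?thesis .
  qed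
  have "evolve \<beta> 1 2 (X (delta (int n + 1))) = evolve \<beta> (int n + 1 + int n) 2 (X (delta (int n + 1)))"
    by (rule fun_cong[OF evolve_parity]) simp
  also have "\<dots> = evolve \<beta> (int n + 1) (n + 2) (delta (int n + 1))"
    by (simp only: X_def evolve_add)
  finally have z: "represents \<beta> (pCons 0 (szego_phi \<alpha> (Suc n))) (evolve \<beta> (int n + 1) (n + 2) (delta (int n + 1)))"
    using represents.shift[OF phi] by simp
  have par: "evolve \<beta> (int n + 1 + 1) (n + 1) = evolve \<beta> (int n) (n + 1)"
    by (rule evolve_parity) simp
  have e: "int (Suc n) = int n + 1" "Suc n + 1 = n + 2" "Suc n - 1 = n"
    by simp_all
  show ?case
    unfolding e
  proof (intro conjI)
    show "represents \<beta> (szego_rev \<alpha> (Suc n)) (evolve \<beta> (int n + 1 + 1) (Suc n) (delta (int n + 1)))"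
      using rev unfolding par[symmetric] unfolding Suc_eq_plus1 .
    show "represents \<beta> (szego_phi \<alpha> (Suc n)) (evolve \<beta> (int n + 1) n (delta (int n + 1)))"
      using phi unfolding X_def .
  qed (rule z)
qed

text \<open>The vector of \<open>szego_phi \<alpha> n\<close> arises from \<open>delta n\<close> by
  half steps that can be moved past an even number of half steps. By unitarity they cancel from the
  inner product, leaving a return amplitude at \<open>n\<close>.\<close>

lemma szego_inner_power:
  "integral\<^sup>L \<mu> (\<lambda>z. cnj (poly (szego_phi \<alpha> n) z) * (z ^ l * poly (szego_phi \<alpha> n) z)) = return_amp \<beta> l (int n)"
proof -
  define v where "v = evolve \<beta> (int n) (n - 1) (delta (int n))"
  have d: "(\<lambda>i. cnj (delta m i)) = delta m" for m :: int by (auto simp: delta_def)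
  have "represents \<beta> (szego_phi \<alpha> n) v" using represents_szego by (simp add: v_def)
  from represents_inner[OF this this, of 0 l]
  have "integral\<^sup>L \<mu> (\<lambda>z. cnj (poly (szego_phi \<alpha> n) z) * (z ^ l * poly (szego_phi \<alpha> n) z)) = sesq v (power_vec l v)"
    by simp
  also have "\<dots> = return_amp \<beta> l (int n)"
  proof (cases n)
    case 0
    then show ?thesis using evolve_return_amp[of \<beta> l 0] by (simp add: v_def d)
  next
    case (Suc m)
    \<comment> \<open>As \<open>n = Suc m\<close>, the index \<open>int n + int m\<close> is odd
      like 1, so the CMV power continues the alternation begun by \<open>v\<close>.\<close>
    have "power_vec l v = evolve \<beta> (int n + int m) (2 * l) v"
      by (rule fun_cong[OF evolve_parity]) (simp add: Suc)
    also have "\<dots> = evolve \<beta> (int n) (m + 2 * l) (delta (int n))"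
      by (simp add: v_def Suc evolve_add)
    also have "\<dots> = evolve \<beta> (int n + int (2 * l)) m (evolve \<beta> (int n) (2 * l) (delta (int n)))"
      by (subst add.commute) (rule evolve_add)
    also have "\<dots> = evolve \<beta> (int n) m (evolve \<beta> (int n) (2 * l) (delta (int n)))"
      by (rule fun_cong[OF evolve_parity]) simp
    finally show ?thesis
      using sesq_evolve[OF \<beta>_le fin_supp_delta, where h = m and s = "int n"
          and g = "evolve \<beta> (int n) (2 * l) (delta (int n))"]
      by (simp add: v_def Suc d return_amp_def)
  qed
  finally show ?thesis .
qed

text \<open>For \<open>j = 0\<close>, the \<open>n\<close> half steps from site \<open>n + 1\<close>
  cannot reach 0. For \<open>j > 0\<close>, the recursion cancels one power of \<open>z\<close>, and
  on the circle the reversed polynomial is \<open>z ^ n\<close> times a conjugate, leaving the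
  conjugate of the orthogonality to \<open>z ^ (n - j)\<close>.\<close>

lemma szego_orthogonal:
  "j < n \<Longrightarrow> integral\<^sup>L \<mu> (\<lambda>z. cnj (z ^ j) * poly (szego_phi \<alpha> n) z) = 0"
proof (induction n arbitrary: j)
  case (Suc n)
  show ?case
  proof (cases j)
    case 0
    have "(\<lambda>i. cnj (delta 0 i)) = delta (0 :: int)" by (auto simp: delta_def)
    moreover have "represents \<beta> (szego_phi \<alpha> (Suc n)) (evolve \<beta> (int n + 1) n (delta (int n + 1)))"
      using represents_szego[of "Suc n"] by (simp add: add.commute)
    ultimately have "integral\<^sup>L \<mu> (\<lambda>z. poly (szego_phi \<alpha> (Suc n)) z) = evolve \<beta> (int n + 1) n (delta (int n + 1)) 0"
      using represents_monomial[of "szego_phi \<alpha> (Suc n)" _ 0 0] by simp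
    also have "\<dots> = 0" by (rule evolve_support[of "int n + 1"]) (auto simp: delta_def)
    finally show ?thesis using 0 by simp
  next
    case (Suc i)
    then have i: "i < n" using Suc.prems by simp
    define d where "d = n - i - 1"
    have n: "n = i + 1 + d" "d < n" using i by (auto simp: d_def)
    have "cnj (z ^ j) * poly (szego_phi \<alpha> (Suc n)) z =
        1 / rho (\<alpha> n) * (cnj (z ^ i) * poly (szego_phi \<alpha> n) z)
        + (- cnj (\<alpha> n) / rho (\<alpha> n)) * cnj (cnj (z ^ d) * poly (szego_phi \<alpha> n) z)" if "cmod z = 1" for z
    proof -
      have z: "cnj z * z = 1" using that by (rule cnj_mult_unit)
      have z': "cnj (z ^ Suc i) * z ^ (i + 1) = 1"
        unfolding Suc_eq_plus1 complex_cnj_power using that by (rule cnj_power_mult_unit)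
      have f1: "cnj (z ^ Suc i) * (z * x) = cnj (z ^ i) * x" for x
      proof -
        have "cnj (z ^ Suc i) * (z * x) = (cnj z * z) * (cnj (z ^ i) * x)" by (simp add: mult_ac)
        then show ?thesis by (simp only: z mult_1)
      qed
      have f2: "cnj (z ^ Suc i) * (z ^ n * x) = z ^ d * x" for x
      proof -
        have "cnj (z ^ Suc i) * (z ^ n * x) = (cnj (z ^ Suc i) * z ^ (i + 1)) * (z ^ d * x)"
          by (subst n(1)) (simp only: power_add mult.assoc)
        then show ?thesis by (simp only: z' mult_1)
      qed
      define P where "P = poly (szego_phi \<alpha> n) z"
      have "cnj (z ^ j) * poly (szego_phi \<alpha> (Suc n)) z =
          1 / rho (\<alpha> n) * (cnj (z ^ Suc i) * (z * P))
          + (- cnj (\<alpha> n) / rho (\<alpha> n)) * (cnj (z ^ Suc i) * (z ^ n * cnj P))"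
        unfolding Suc szego_Suc poly_add poly_smult poly_pCons szego_rev_circle[OF that] P_def[symmetric]
        by (simp only: add_0 distrib_left mult.left_commute)
      then show ?thesis
        unfolding f1 f2 by (simp add: P_def)
    qed
    then have "integral\<^sup>L \<mu> (\<lambda>z. cnj (z ^ j) * poly (szego_phi \<alpha> (Suc n)) z) =
      integral\<^sup>L \<mu> (\<lambda>z. 1 / rho (\<alpha> n) * (cnj (z ^ i) * poly (szego_phi \<alpha> n) z)
        + (- cnj (\<alpha> n) / rho (\<alpha> n)) * cnj (cnj (z ^ d) * poly (szego_phi \<alpha> n) z))"
      by (rule circle_integral_cong[OF circle])
    also have "\<dots> = 1 / rho (\<alpha> n) * integral\<^sup>L \<mu> (\<lambda>z. cnj (z ^ i) * poly (szego_phi \<alpha> n) z)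
        + (- cnj (\<alpha> n) / rho (\<alpha> n)) * cnj (integral\<^sup>L \<mu> (\<lambda>z. cnj (z ^ d) * poly (szego_phi \<alpha> n) z))"
      unfolding Bochner_Integration.integral_cnj[symmetric]
      by (subst Bochner_Integration.integral_add) (auto intro!: continuous_intros)
    finally show ?thesis using Suc.IH[OF i] Suc.IH[OF n(2)] by simp
  qed
qed simp

lemma szego_norm_pos: "szego_norm \<alpha> n > 0"
  unfolding szego_norm_def
  by (intro prod_pos) (use \<alpha> in \<open>auto simp: abs_square_less_1\<close>)

lemma szego_normalized: "integral\<^sup>L \<mu> (\<lambda>z. cnj (poly (szego_phi \<alpha> n) z) * poly (szego_phi \<alpha> n) z) = 1"
  using szego_inner_power[of n 0] by (simp add: return_amp_def delta_def)

lemma szego_normalized_real: "integral\<^sup>L \<mu> (\<lambda>z. (cmod (poly (szego_phi \<alpha> n) z))\<^sup>2) = 1"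
proof -
  have "complex_of_real (integral\<^sup>L \<mu> (\<lambda>z. (cmod (poly (szego_phi \<alpha> n) z))\<^sup>2)) =
      integral\<^sup>L \<mu> (\<lambda>z. complex_of_real ((cmod (poly (szego_phi \<alpha> n) z))\<^sup>2))"
    by (rule integral_complex_of_real[symmetric])
  also have "\<dots> = 1"
    using szego_normalized[of n] by (simp only: complex_norm_square mult.commute)
  finally show ?thesis by (simp only: of_real_eq_1_iff)
qed

section \<open>Identification of the orthonormal polynomials\<close>

lemma integral_poly_right:
  assumes "\<And>j. j \<le> degree q \<Longrightarrow> integral\<^sup>L \<mu> (\<lambda>z. cnj (poly p z) * z ^ j) = 0"
  shows "integral\<^sup>L \<mu> (\<lambda>z. cnj (poly p z) * poly q z) = 0"
proof -
  have "integral\<^sup>L \<mu> (\<lambda>z. cnj (poly p z) * poly q z)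
     = integral\<^sup>L \<mu> (\<lambda>z. \<Sum>j\<le>degree q. coeff q j * (cnj (poly p z) * z ^ j))"
    by (simp add: poly_altdef[of q] sum_distrib_left mult_ac)
  also have "\<dots> = (\<Sum>j\<le>degree q. coeff q j * integral\<^sup>L \<mu> (\<lambda>z. cnj (poly p z) * z ^ j))"
    by (subst Bochner_Integration.integral_sum) (auto intro!: continuous_intros)
  finally show ?thesis using assms by simp
qed

lemma szego_monic_orthogonal:
  "is_monic_orthogonal_poly \<mu> n (smult (of_real (1 / szego_norm \<alpha> n)) (szego_phi \<alpha> n))"
proof -
  have k: "szego_norm \<alpha> n \<noteq> 0" using szego_norm_pos[of n] by simp
  have "degree (szego_phi \<alpha> n) = n"
    using szego_degree[of \<alpha> n] k by (metis le_antisym le_degree of_real_eq_0_iff)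
  then show ?thesis
    using szego_degree[of \<alpha> n] k szego_orthogonal[of _ n]
    by (simp add: is_monic_orthogonal_poly_def mult.left_commute flip: complex_cnj_power)
qed

text \<open>The difference \<open>r\<close> of two candidates is tested against
  \<open>szego_phi \<alpha> d\<close>, where \<open>d\<close> is its degree: the normalization of
  that polynomial makes the inner product detect the leading coefficient of
  \<open>r\<close>.\<close>

lemma monic_orthogonal_poly_szego:
  "monic_orthogonal_poly \<mu> n = smult (of_real (1 / szego_norm \<alpha> n)) (szego_phi \<alpha> n)"
  unfolding monic_orthogonal_poly_def
proof (rule the_equality)
  show "is_monic_orthogonal_poly \<mu> n (smult (of_real (1 / szego_norm \<alpha> n)) (szego_phi \<alpha> n))"
    by (rule szego_monic_orthogonal)
next
  fix p assume p: "is_monic_orthogonal_poly \<mu> n p"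
  define q where "q = smult (of_real (1 / szego_norm \<alpha> n)) (szego_phi \<alpha> n)"
  have q: "is_monic_orthogonal_poly \<mu> n q" unfolding q_def by (rule szego_monic_orthogonal)
  define r where "r = p - q"
  have "r = 0"
  proof (rule ccontr)
    assume r0: "r \<noteq> 0"
    define d where "d = degree r"
    have "coeff r n = 0" "degree r \<le> n"
      using p q by (auto simp: r_def is_monic_orthogonal_poly_def intro: degree_diff_le)
    then have d: "d < n" using r0 unfolding d_def by (metis le_neq_implies_less leading_coeff_0_iff)
    have orth: "integral\<^sup>L \<mu> (\<lambda>z. cnj (z ^ j) * poly r z) = 0" if "j < n" for j
    proof -
      have "integral\<^sup>L \<mu> (\<lambda>z. cnj (z ^ j) * poly r z)
          = integral\<^sup>L \<mu> (\<lambda>z. cnj (z ^ j) * poly p z) - integral\<^sup>L \<mu> (\<lambda>z. cnj (z ^ j) * poly q z)"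
        unfolding r_def poly_diff right_diff_distrib
        by (intro Bochner_Integration.integral_diff int_cont continuous_intros)
      then show ?thesis using p q that by (simp add: is_monic_orthogonal_poly_def)
    qed
    have flip: "integral\<^sup>L \<mu> (\<lambda>z. cnj (f z) * z ^ j) = cnj (integral\<^sup>L \<mu> (\<lambda>z. cnj (z ^ j) * f z))" for f j
      using Bochner_Integration.integral_cnj[of \<mu> "\<lambda>z. cnj (z ^ j) * f z"] by (simp add: mult.commute)
    define e where "e = szego_phi \<alpha> d"
    have e: "degree e \<le> d" "coeff e d \<noteq> 0"
      using szego_degree[of \<alpha> d] szego_norm_pos[of d] by (auto simp: e_def)
    have "integral\<^sup>L \<mu> (\<lambda>z. cnj (poly r z) * poly e z) = 0"
    proof (rule integral_poly_right)
      fix j assume "j \<le> degree e"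
      then show "integral\<^sup>L \<mu> (\<lambda>z. cnj (poly r z) * z ^ j) = 0"
        unfolding flip using orth[of j] e d by simp
    qed
    moreover have "integral\<^sup>L \<mu> (\<lambda>z. cnj (poly e z) * poly r z) = cnj (integral\<^sup>L \<mu> (\<lambda>z. cnj (poly r z) * poly e z))"
      using Bochner_Integration.integral_cnj[of \<mu> "\<lambda>z. cnj (poly r z) * poly e z"] by (simp add: mult.commute)
    ultimately have er: "integral\<^sup>L \<mu> (\<lambda>z. cnj (poly e z) * poly r z) = 0" by simp
    \<comment> \<open>This combination cancels degree \<open>d\<close>, so \<open>t\<close> is
      orthogonal to \<open>e\<close>, as \<open>r\<close> is; hence \<open>coeff r d\<close> times
      the squared norm 1 of \<open>e\<close> vanishes.\<close>
    define t where "t = smult (coeff r d) e - smult (coeff e d) r"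
    have "degree t \<le> d" "coeff t d = 0"
      using e by (auto simp: t_def d_def intro!: degree_diff_le order.trans[OF degree_smult_le])
    then have t: "t = 0 \<or> degree t < d" by (metis le_neq_implies_less leading_coeff_0_iff)
    have et: "integral\<^sup>L \<mu> (\<lambda>z. cnj (poly e z) * poly t z) = 0"
    proof (cases "t = 0")
      case False
      show ?thesis
      proof (rule integral_poly_right)
        fix j assume "j \<le> degree t"
        then show "integral\<^sup>L \<mu> (\<lambda>z. cnj (poly e z) * z ^ j) = 0"
          unfolding flip e_def using t False by (subst szego_orthogonal) auto
      qed
    qed simp
    have "integral\<^sup>L \<mu> (\<lambda>z. cnj (poly e z) * poly t z) =
        integral\<^sup>L \<mu> (\<lambda>z. coeff r d * (cnj (poly e z) * poly e z) - coeff e d * (cnj (poly e z) * poly r z))"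
      by (simp add: t_def algebra_simps)
    also have "\<dots> = coeff r d * integral\<^sup>L \<mu> (\<lambda>z. cnj (poly e z) * poly e z)
        - coeff e d * integral\<^sup>L \<mu> (\<lambda>z. cnj (poly e z) * poly r z)"
      by (subst Bochner_Integration.integral_diff) (auto intro!: continuous_intros)
    finally have "coeff r d = 0" using er et by (simp add: szego_normalized e_def)
    then show False using r0 by (simp add: d_def)
  qed
  then show "p = smult (of_real (1 / szego_norm \<alpha> n)) (szego_phi \<alpha> n)" by (simp add: r_def q_def)
qed

lemma orthonormal_poly_szego: "orthonormal_poly \<mu> n = szego_phi \<alpha> n"
proof -
  define k where "k = szego_norm \<alpha> n"
  have k: "k > 0" using szego_norm_pos by (simp add: k_def)
  note szego_normalized_real[of n]
  then have "integral\<^sup>L \<mu> (\<lambda>z. (cmod (poly (smult (of_real (1 / k)) (szego_phi \<alpha> n)) z))\<^sup>2) = (1 / k)\<^sup>2"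
    using k by (simp add: norm_mult norm_divide power_divide)
  then show ?thesis
    using k unfolding orthonormal_poly_def monic_orthogonal_poly_szego Let_def k_def[symmetric]
    by (simp add: real_sqrt_divide)
qed

section \<open>The measures with density the squared modulus of an orthonormal polynomial\<close>

lemma op_measure_integral:
  assumes "continuous_on unit_circle f"
  shows "integral\<^sup>L (op_measure \<mu> n) f =
     integral\<^sup>L \<mu> (\<lambda>z. of_real ((cmod (poly (szego_phi \<alpha> n) z))\<^sup>2) * (f z :: complex))"
  unfolding op_measure_def orthonormal_poly_szego
  by (subst integral_density)
    (auto simp: scaleR_conv_of_real intro!: circle_measure_measurable[OF circle] assms continuous_intros)

lemma op_measure_moments: "integral\<^sup>L (op_measure \<mu> n) (\<lambda>z. z ^ l) = return_amp \<beta> l (int n)"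
proof -
  have "integral\<^sup>L (op_measure \<mu> n) (\<lambda>z. z ^ l) =
     integral\<^sup>L \<mu> (\<lambda>z. of_real ((cmod (poly (szego_phi \<alpha> n) z))\<^sup>2) * z ^ l)"
    by (intro op_measure_integral continuous_intros)
  also have "\<dots> = integral\<^sup>L \<mu> (\<lambda>z. cnj (poly (szego_phi \<alpha> n) z) * (z ^ l * poly (szego_phi \<alpha> n) z))"
    by (simp only: complex_norm_square mult_ac)
  finally show ?thesis by (simp only: szego_inner_power)
qed

lemma op_measure_prob: "prob_space (op_measure \<mu> n)" and op_measure_circle: "circle_measure (op_measure \<mu> n)"
proof -
  interpret finite_measure \<mu> using circle by (simp add: circle_measure_def)
  let ?f = "\<lambda>z. (cmod (poly (szego_phi \<alpha> n) z))\<^sup>2"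
  have "integrable \<mu> ?f"
    by (intro circle_measure_integrable[OF circle] continuous_intros)
  then have "integral\<^sup>N \<mu> (\<lambda>z. ennreal (?f z)) = 1"
    by (subst nn_integral_eq_integral) (auto simp: szego_normalized_real)
  moreover have "(\<lambda>z. ennreal (?f z)) \<in> borel_measurable \<mu>"
    by (intro measurable_compose[OF circle_measure_measurable[OF circle] measurable_ennreal] continuous_intros)
  then have "emeasure (density \<mu> (\<lambda>z. ennreal (?f z))) (space \<mu>) = integral\<^sup>N \<mu> (\<lambda>z. ennreal (?f z))"
    by (subst emeasure_density) (auto intro!: nn_integral_cong)
  ultimately show 1: "prob_space (op_measure \<mu> n)"
    unfolding op_measure_def orthonormal_poly_szego by (intro prob_spaceI) simp
  then interpret prob_space "op_measure \<mu> n" .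
  show "circle_measure (op_measure \<mu> n)"
    using circle finite_measure_axioms by (simp add: circle_measure_def op_measure_def)
qed

end

section \<open>Weak convergence on the circle\<close>

definition circle_angle :: "complex \<Rightarrow> real" where
  "circle_angle z = (if z = - 1 then pi else 2 * arctan (Im z / (1 + Re z)))"

lemma circle_angle_measurable [measurable]: "circle_angle \<in> borel_measurable borel"
  unfolding circle_angle_def by measurable

lemma circle_angle_bound: "\<bar>circle_angle z\<bar> \<le> pi"
  using arctan_lbound[of "Im z / (1 + Re z)"] arctan_ubound[of "Im z / (1 + Re z)"]
  by (auto simp: circle_angle_def abs_le_iff)

text \<open>On the circle \<open>Im z / (1 + Re z)\<close> is the tangent of half the angle; it
  breaks down only at -1, where the angle is set to \<open>pi\<close>.\<close>

lemma cis_circle_angle: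
  assumes "cmod z = 1"
  shows "cis (circle_angle z) = z"
proof (cases "z = - 1")
  case True
  then show ?thesis by (simp add: circle_angle_def cis_pi)
next
  case False
  define a b where "a = Re z" and "b = Im z"
  have ab: "a\<^sup>2 + b\<^sup>2 = 1" using assms by (metis a_def b_def cmod_power2 power_one)
  have "1 + a \<noteq> 0"
  proof
    assume "1 + a = 0"
    then have "a = - 1" by simp
    with ab have "b = 0" by simp
    with \<open>a = - 1\<close> False show False by (simp add: complex_eq_iff a_def b_def)
  qed
  define x where "x = b / (1 + a)"
  have "1 + x\<^sup>2 = ((1 + a)\<^sup>2 + b\<^sup>2) / (1 + a)\<^sup>2"
    using \<open>1 + a \<noteq> 0\<close> by (simp add: x_def power_divide add_divide_distrib)
  also have "(1 + a)\<^sup>2 + b\<^sup>2 = 2 * (1 + a)" using ab by (simp add: power2_sum)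
  also have "2 * (1 + a) / (1 + a)\<^sup>2 = 2 / (1 + a)"
    unfolding power2_eq_square using \<open>1 + a \<noteq> 0\<close> by (rule nonzero_mult_divide_mult_cancel_right)
  finally have x: "1 + x\<^sup>2 = 2 / (1 + a)" .
  have pos: "1 + x\<^sup>2 > 0" by (smt (verit) zero_le_power2)
  then have sq: "(sqrt (1 + x\<^sup>2))\<^sup>2 = 1 + x\<^sup>2" by simp
  have "cos (2 * arctan x) = 2 / (1 + x\<^sup>2) - 1"
    unfolding cos_double_cos cos_arctan power_divide sq by simp
  also have "\<dots> = a" unfolding x by (simp add: field_simps)
  finally have c: "cos (2 * arctan x) = a" .
  have "sin (2 * arctan x) = 2 * x / (sqrt (1 + x\<^sup>2))\<^sup>2"
    unfolding sin_double cos_arctan sin_arctan by (simp add: power2_eq_square)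
  also have "\<dots> = b" unfolding sq unfolding x using \<open>1 + a \<noteq> 0\<close> by (simp add: x_def)
  finally have "sin (2 * arctan x) = b" .
  with c False show ?thesis
    by (simp add: circle_angle_def complex_eq_iff x_def a_def b_def)
qed

text \<open>Angles transfer the measures to a tight family on the line, and \<open>cis\<close>
  brings the limit back. Test functions enter only as \<open>f (cis t)\<close>, which is continuous
  despite the jump of the angle at -1.\<close>

lemma circle_measure_convergent_subsequence:
  assumes "\<And>n. circle_measure (\<mu>s n)" "\<And>n. prob_space (\<mu>s n)"
  obtains r \<nu> where "strict_mono (r :: nat \<Rightarrow> nat)" "circle_measure \<nu>" "prob_space \<nu>"
    "weak_conv_circle (\<lambda>n. \<mu>s (r n)) \<nu>"
proof -
  define D where "D n = distr (\<mu>s n) borel circle_angle" for n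
  have m: "circle_angle \<in> borel_measurable (\<mu>s n)" for n
  proof -
    have "circle_angle \<in> borel_measurable (restrict_space borel unit_circle)"
      by (rule measurable_restrict_space1) measurable
    then show ?thesis
      using assms(1)[of n] measurable_cong_sets[of "\<mu>s n" "restrict_space borel unit_circle"]
      by (auto simp: circle_measure_def)
  qed
  have D: "real_distribution (D n)" for n
    unfolding D_def using assms(2)[of n] m by (intro prob_space.real_distribution_distr)
  \<comment> \<open>4 exceeds \<open>pi\<close>, so one bounded interval carries all the
    mass.\<close>
  have "measure (D n) {- 4<..4} = 1" for n
  proof -
    have "circle_angle -` {- 4<..4} \<inter> space (\<mu>s n) = space (\<mu>s n)"
      using circle_angle_bound pi_less_4 by (auto simp: abs_le_iff) (smt (verit))+
    then show ?thesis
      unfolding D_def using m prob_space.prob_space[OF assms(2)] by (subst measure_distr) auto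
  qed
  then have "tight D"
    unfolding tight_def using D by (intro conjI allI impI exI[of _ "- 4"] exI[of _ 4]) auto
  then obtain r M where r: "strict_mono (r :: nat \<Rightarrow> nat)" and M: "real_distribution M"
    and conv: "weak_conv_m (D \<circ> id \<circ> r) M"
    using tight_imp_convergent_subsubsequence[of D id] by (auto simp: strict_mono_id)
  have conv: "weak_conv_m (\<lambda>n. D (r n)) M" using conv by (simp add: comp_def)
  interpret M: real_distribution M by (rule M)
  define \<nu> where "\<nu> = distr M (restrict_space borel unit_circle) cis"
  have "cis \<in> borel_measurable borel"
    by (intro borel_measurable_continuous_onI continuous_intros)
  then have "cis \<in> borel_measurable M"
    by (simp add: measurable_cong_sets[OF M.events_eq_borel refl])
  then have cis: "cis \<in> measurable M (restrict_space borel unit_circle)"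
    by (intro measurable_restrict_space2) (auto simp: unit_circle_def)
  have prob: "prob_space \<nu>" unfolding \<nu>_def by (rule M.prob_space_distr[OF cis])
  then have circ: "circle_measure \<nu>"
    by (simp add: circle_measure_def prob_space.finite_measure) (simp add: \<nu>_def)
  have "weak_conv_circle (\<lambda>n. \<mu>s (r n)) \<nu>"
    unfolding weak_conv_circle_def
  proof (intro allI impI)
    fix f :: "complex \<Rightarrow> complex" assume f: "continuous_on unit_circle f"
    have "compact (f ` unit_circle)"
      using f by (intro compact_continuous_image) (auto simp: unit_circle_def)
    then have "bounded (f ` unit_circle)" by (rule compact_imp_bounded)
    then obtain B where B: "\<And>z. z \<in> unit_circle \<Longrightarrow> norm (f z) \<le> B" by (auto simp: bounded_iff)
    have "continuous_on UNIV (\<lambda>t. f (cis t))"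
      by (rule continuous_on_compose2[OF f]) (auto simp: unit_circle_def intro!: continuous_intros)
    then have cont: "isCont (\<lambda>t. f (cis t)) t" for t
      by (simp add: continuous_on_eq_continuous_at)
    have fm: "f \<in> borel_measurable (restrict_space borel unit_circle)"
      using f by (rule borel_measurable_continuous_on_restrict)
    have "norm (f (cis t)) \<le> B" for t by (rule B) (simp add: unit_circle_def)
    then have "(\<lambda>n. integral\<^sup>L (D (r n)) (\<lambda>t. f (cis t))) \<longlonglongrightarrow> integral\<^sup>L M (\<lambda>t. f (cis t))"
      by (rule weak_conv_imp_integral_bdd_continuous_conv[OF D M conv cont])
    moreover have "integral\<^sup>L (D (r n)) (\<lambda>t. f (cis t)) = integral\<^sup>L (\<mu>s (r n)) f" for n
    proof -
      have "(\<lambda>t. f (cis t)) \<in> borel_measurable borel"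
        using cont by (intro borel_measurable_continuous_onI continuous_at_imp_continuous_on) auto
      then have "integral\<^sup>L (D (r n)) (\<lambda>t. f (cis t)) = integral\<^sup>L (\<mu>s (r n)) (\<lambda>z. f (cis (circle_angle z)))"
        unfolding D_def using m by (subst integral_distr) auto
      also have "\<dots> = integral\<^sup>L (\<mu>s (r n)) f"
        by (rule circle_integral_cong[OF assms(1)]) (simp add: cis_circle_angle)
      finally show ?thesis by simp
    qed
    moreover have "integral\<^sup>L \<nu> f = integral\<^sup>L M (\<lambda>t. f (cis t))"
      unfolding \<nu>_def using cis fm by (rule integral_distr)
    ultimately show "(\<lambda>n. integral\<^sup>L (\<mu>s (r n)) f) \<longlonglongrightarrow> integral\<^sup>L \<nu> f" by simp
  qed
  then show ?thesis using that r circ prob by blast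
qed

section \<open>Trigonometric approximation and the moment criterion\<close>

lemma unit_circle_cancel: "cmod z = 1 \<Longrightarrow> cnj z ^ n * (z ^ n * x) = x"
  by (simp add: cnj_power_mult_unit flip: mult.assoc)

text \<open>On the circle \<open>cnj z\<close> is the inverse of \<open>z\<close>, so this form
  describes Laurent polynomials over a common denominator.\<close>

lemma real_polynomial_function_on_circle:
  "real_polynomial_function g \<Longrightarrow>
     \<exists>n p. \<forall>z. cmod z = 1 \<longrightarrow> complex_of_real (g z) = cnj z ^ n * poly p z"
proof (induction rule: real_polynomial_function.induct)
  case (linear f)
  \<comment> \<open>\<open>A\<close> is chosen so that \<open>f z\<close> is \<open>A * z\<close>
    plus its conjugate.\<close>
  define A where "A = Complex (f 1 / 2) (- f \<i> / 2)"
  have "complex_of_real (f z) = cnj z ^ 1 * poly [:cnj A, 0, A:] z" if "cmod z = 1" for z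
  proof -
    have "z = Re z *\<^sub>R 1 + Im z *\<^sub>R \<i>" by (simp add: complex_eq_iff)
    then have "f z = f (Re z *\<^sub>R 1 + Im z *\<^sub>R \<i>)" by (rule arg_cong)
    also have "\<dots> = Re z * f 1 + Im z * f \<i>"
      using linear by (simp add: linear_simps)
    finally have "complex_of_real (f z) = z * A + cnj z * cnj A"
      by (simp add: A_def complex_eq_iff)
    also have "\<dots> = (cnj z * z) * z * A + cnj z * cnj A"
      by (simp add: cnj_mult_unit[OF that])
    finally show ?thesis by (simp add: algebra_simps)
  qed
  then show ?case by blast
next
  case (const c)
  have "complex_of_real c = cnj z ^ 0 * poly [:of_real c:] z" for z by simp
  then show ?case by blast
next
  case (add f g)
  then obtain n p m q where
    "\<And>z. cmod z = 1 \<Longrightarrow> complex_of_real (f z) = cnj z ^ n * poly p z"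
    "\<And>z. cmod z = 1 \<Longrightarrow> complex_of_real (g z) = cnj z ^ m * poly q z" by blast
  then have "complex_of_real (f z + g z) = cnj z ^ (n + m) * poly (monom 1 m * p + monom 1 n * q) z"
    if "cmod z = 1" for z
    using that unit_circle_cancel[OF that]
    by (simp add: poly_monom power_add distrib_left mult.assoc)
      (simp add: mult.left_commute[of "cnj z ^ n" "cnj z ^ m"] unit_circle_cancel)
  then show ?case by blast
next
  case (mult f g)
  then obtain n p m q where
    "\<And>z. cmod z = 1 \<Longrightarrow> complex_of_real (f z) = cnj z ^ n * poly p z"
    "\<And>z. cmod z = 1 \<Longrightarrow> complex_of_real (g z) = cnj z ^ m * poly q z" by blast
  then have "complex_of_real (f z * g z) = cnj z ^ (n + m) * poly (p * q) z"
    if "cmod z = 1" for z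
    using that by (simp add: power_add mult_ac)
  then show ?case by blast
qed

text \<open>Stone-Weierstrass for the real and the imaginary part, brought over the common
  denominator of degree \<open>n + m\<close>.\<close>

lemma circle_trigonometric_approximation:
  fixes f :: "complex \<Rightarrow> complex"
  assumes "continuous_on unit_circle f" "e > 0"
  obtains n p where "\<And>z. cmod z = 1 \<Longrightarrow> cmod (f z - cnj z ^ n * poly p z) < e"
proof -
  have "compact unit_circle" by (simp add: unit_circle_def)
  moreover have "continuous_on unit_circle (\<lambda>z. Re (f z))" "continuous_on unit_circle (\<lambda>z. Im (f z))"
    using assms(1) by (auto intro: continuous_intros)
  ultimately obtain g h where g: "real_polynomial_function g" "\<And>z. z \<in> unit_circle \<Longrightarrow> \<bar>Re (f z) - g z\<bar> < e / 2"
    and h: "real_polynomial_function h" "\<And>z. z \<in> unit_circle \<Longrightarrow> \<bar>Im (f z) - h z\<bar> < e / 2"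
    using Stone_Weierstrass_real_polynomial_function[of unit_circle] assms(2) by (metis half_gt_zero)
  obtain n p m q where n: "\<And>z. cmod z = 1 \<Longrightarrow> complex_of_real (g z) = cnj z ^ n * poly p z"
    and m: "\<And>z. cmod z = 1 \<Longrightarrow> complex_of_real (h z) = cnj z ^ m * poly q z"
    using real_polynomial_function_on_circle[OF g(1)] real_polynomial_function_on_circle[OF h(1)] by blast
  have "cmod (f z - cnj z ^ (n + m) * poly (monom 1 m * p + smult \<i> (monom 1 n * q)) z) < e"
    if z: "cmod z = 1" for z
  proof -
    have "cnj z ^ (n + m) * poly (monom 1 m * p + smult \<i> (monom 1 n * q)) z =
        cnj z ^ n * (cnj z ^ m * (z ^ m * poly p z)) + \<i> * (cnj z ^ m * (cnj z ^ n * (z ^ n * poly q z)))"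
      by (simp add: poly_monom power_add algebra_simps)
    also have "\<dots> = complex_of_real (g z) + \<i> * complex_of_real (h z)"
      by (simp add: unit_circle_cancel[OF z] n[OF z] m[OF z])
    finally have "f z - cnj z ^ (n + m) * poly (monom 1 m * p + smult \<i> (monom 1 n * q)) z
        = Complex (Re (f z) - g z) (Im (f z) - h z)"
      by (simp add: complex_eq_iff)
    also have "cmod \<dots> \<le> \<bar>Re (f z) - g z\<bar> + \<bar>Im (f z) - h z\<bar>"
      by (rule order.trans[OF cmod_le]) simp
    also have "\<dots> < e" using g(2)[of z] h(2)[of z] z by (auto simp: unit_circle_def)
    finally show ?thesis .
  qed
  then show ?thesis by (rule that)
qed

text \<open>Moments of negative order are conjugates, so integrals of all trigonometric polynomials
  converge. Total mass 1 makes the approximation error uniform in \<open>n\<close>.\<close>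

lemma weak_conv_circle_moments:
  assumes \<mu>s: "\<And>n. circle_measure (\<mu>s n)" "\<And>n. prob_space (\<mu>s n)"
    and \<nu>: "circle_measure \<nu>" "prob_space \<nu>"
    and moments: "\<And>l. (\<lambda>n. integral\<^sup>L (\<mu>s n) (\<lambda>z. z ^ l)) \<longlonglongrightarrow> integral\<^sup>L \<nu> (\<lambda>z. z ^ l)"
  shows "weak_conv_circle \<mu>s \<nu>"
  unfolding weak_conv_circle_def
proof (intro allI impI)
  fix f :: "complex \<Rightarrow> complex" assume f: "continuous_on unit_circle f"
  have mono: "(\<lambda>n. integral\<^sup>L (\<mu>s n) (\<lambda>z. cnj z ^ m * z ^ j)) \<longlonglongrightarrow> integral\<^sup>L \<nu> (\<lambda>z. cnj z ^ m * z ^ j)" for m j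
  proof (cases "m \<le> j")
    case True
    then obtain d where d: "j = m + d" by (metis le_Suc_ex)
    have "integral\<^sup>L M (\<lambda>z. cnj z ^ m * z ^ j) = integral\<^sup>L M (\<lambda>z. z ^ d)" if "circle_measure M" for M
      by (rule circle_integral_cong[OF that]) (simp add: d power_add unit_circle_cancel)
    then show ?thesis using moments \<mu>s(1) \<nu>(1) by simp
  next
    case False
    then obtain d where d: "m = d + j" by (metis le_Suc_ex nat_le_linear add.commute)
    have "integral\<^sup>L M (\<lambda>z. cnj z ^ m * z ^ j) = cnj (integral\<^sup>L M (\<lambda>z. z ^ d))" if "circle_measure M" for M
      unfolding Bochner_Integration.integral_cnj[symmetric]
      by (rule circle_integral_cong[OF that]) (simp add: d power_add mult.assoc cnj_power_mult_unit)
    then show ?thesis using moments \<mu>s(1) \<nu>(1) by (simp add: tendsto_cnj)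
  qed
  have trig: "(\<lambda>n. integral\<^sup>L (\<mu>s n) (\<lambda>z. cnj z ^ m * poly p z)) \<longlonglongrightarrow> integral\<^sup>L \<nu> (\<lambda>z. cnj z ^ m * poly p z)" for m p
  proof -
    have "integral\<^sup>L M (\<lambda>z. cnj z ^ m * poly p z) = (\<Sum>j\<le>degree p. coeff p j * integral\<^sup>L M (\<lambda>z. cnj z ^ m * z ^ j))"
      if "circle_measure M" for M
    proof -
      have "integral\<^sup>L M (\<lambda>z. cnj z ^ m * poly p z) = integral\<^sup>L M (\<lambda>z. \<Sum>j\<le>degree p. coeff p j * (cnj z ^ m * z ^ j))"
        by (simp add: poly_altdef sum_distrib_left mult.left_commute)
      also have "\<dots> = (\<Sum>j\<le>degree p. integral\<^sup>L M (\<lambda>z. coeff p j * (cnj z ^ m * z ^ j)))"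
        by (rule Bochner_Integration.integral_sum) (intro circle_measure_integrable[OF that] continuous_intros)
      finally show ?thesis by simp
    qed
    then show ?thesis using \<mu>s(1) \<nu>(1) by (auto intro!: tendsto_intros mono)
  qed
  show "(\<lambda>n. integral\<^sup>L (\<mu>s n) f) \<longlonglongrightarrow> integral\<^sup>L \<nu> f"
  proof (rule LIMSEQ_I)
    fix e :: real assume e: "e > 0"
    obtain m p where mp: "\<And>z. cmod z = 1 \<Longrightarrow> cmod (f z - cnj z ^ m * poly p z) < e / 3"
      using circle_trigonometric_approximation[OF f, of "e / 3"] e by auto
    define g where "g = (\<lambda>z. cnj z ^ m * poly p z)"
    have g: "continuous_on unit_circle g" unfolding g_def by (intro continuous_intros)
    have close: "cmod (integral\<^sup>L M f - integral\<^sup>L M g) \<le> e / 3" if M: "circle_measure M" "prob_space M" for M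
    proof -
      interpret prob_space M by (rule M(2))
      have "integral\<^sup>L M f - integral\<^sup>L M g = integral\<^sup>L M (\<lambda>z. f z - g z)"
        by (rule Bochner_Integration.integral_diff[symmetric]) (intro circle_measure_integrable[OF M(1)] f g)+
      also have "cmod \<dots> \<le> integral\<^sup>L M (\<lambda>z. cmod (f z - g z))" by (rule integral_norm_bound)
      also have "\<dots> \<le> integral\<^sup>L M (\<lambda>z. e / 3)"
        using mp circle_measure_space[OF M(1)]
        by (intro integral_mono circle_measure_integrable[OF M(1)] continuous_intros f g)
          (auto simp: g_def unit_circle_def less_imp_le)
      also have "\<dots> = e / 3" by (simp add: prob_space)
      finally show ?thesis .
    qed
    obtain n0 where n0: "\<And>n. n \<ge> n0 \<Longrightarrow> cmod (integral\<^sup>L (\<mu>s n) g - integral\<^sup>L \<nu> g) < e / 3"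
      using LIMSEQ_D[OF trig[of m p], of "e / 3"] e unfolding g_def by auto
    have "cmod (integral\<^sup>L (\<mu>s n) f - integral\<^sup>L \<nu> f) < e" if "n \<ge> n0" for n
    proof -
      have "integral\<^sup>L (\<mu>s n) f - integral\<^sup>L \<nu> f = (integral\<^sup>L (\<mu>s n) f - integral\<^sup>L (\<mu>s n) g)
          + (integral\<^sup>L (\<mu>s n) g - integral\<^sup>L \<nu> g) + - (integral\<^sup>L \<nu> f - integral\<^sup>L \<nu> g)" by simp
      also have "cmod \<dots> \<le> cmod (integral\<^sup>L (\<mu>s n) f - integral\<^sup>L (\<mu>s n) g)
          + cmod (integral\<^sup>L (\<mu>s n) g - integral\<^sup>L \<nu> g) + cmod (- (integral\<^sup>L \<nu> f - integral\<^sup>L \<nu> g))"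
        by (rule norm_triangle_le[OF add_right_mono[OF norm_triangle_ineq]])
      also have "\<dots> < e"
        using close[OF \<mu>s, of n] close[OF \<nu>] n0[OF that] by (simp only: norm_minus_cancel)
      finally show ?thesis .
    qed
    then show "\<exists>n0. \<forall>n\<ge>n0. cmod (integral\<^sup>L (\<mu>s n) f - integral\<^sup>L \<nu> f) < e" by blast
  qed
qed

section \<open>Right limits\<close>

lemma tendsto_rho: "(a \<longlongrightarrow> x) F \<Longrightarrow> ((\<lambda>j. rho (a j)) \<longlongrightarrow> rho x) F"
  unfolding rho_def by (intro tendsto_intros)

lemma tendsto_half_step:
  assumes "\<And>i. (\<lambda>j. \<beta> j i) \<longlonglongrightarrow> b i" "\<And>i. (\<lambda>j. f j i) \<longlonglongrightarrow> g i"
  shows "(\<lambda>j. half_step (\<beta> j) e (f j) i) \<longlonglongrightarrow> half_step b e g i"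
  unfolding half_step_def by (cases "even (i + e)") (auto intro!: tendsto_intros tendsto_rho assms)

lemma tendsto_evolve:
  assumes "\<And>i. (\<lambda>j. \<beta> j i) \<longlonglongrightarrow> b i"
  shows "(\<lambda>j. evolve (\<beta> j) s h f i) \<longlonglongrightarrow> evolve b s h f i"
  by (induction h arbitrary: i) (auto intro: tendsto_half_step assms)

lemma tendsto_return_amp:
  assumes "\<And>i. (\<lambda>j. \<beta> j i) \<longlonglongrightarrow> b i"
  shows "(\<lambda>j. return_amp (\<beta> j) l n) \<longlonglongrightarrow> return_amp b l n"
  unfolding return_amp_def by (rule tendsto_evolve[OF assms])

text \<open>Translation turns the amplitude at \<open>n + N j\<close> into the amplitude at
  \<open>n\<close> for coefficients that converge entrywise. At each fixed index the filling value
  \<open>a\<close> is seen for finitely many \<open>j\<close> only.\<close>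

lemma return_amp_right_limit:
  assumes "filterlim N at_top sequentially" "\<And>n. (\<lambda>j. \<alpha> (nat (n + N j))) \<longlonglongrightarrow> b n"
  shows "(\<lambda>j. return_amp (extend a \<alpha>) l (n + N j)) \<longlonglongrightarrow> return_amp b l n"
proof -
  have "(\<lambda>j. extend a \<alpha> (i + N j)) \<longlonglongrightarrow> b i" for i
  proof (rule Lim_transform_eventually[OF assms(2)])
    have "\<forall>\<^sub>F j in sequentially. N j \<ge> - i"
      using assms(1) by (simp add: filterlim_at_top)
    then show "\<forall>\<^sub>F j in sequentially. \<alpha> (nat (i + N j)) = extend a \<alpha> (i + N j)"
      by eventually_elim (simp add: extend_def)
  qed
  then have "(\<lambda>j. return_amp (\<lambda>i. extend a \<alpha> (i + N j)) l n) \<longlonglongrightarrow> return_amp b l n"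
    by (rule tendsto_return_amp)
  then show ?thesis by (simp only: return_amp_shift)
qed

text \<open>Sequential compactness of a countable product of closed discs, applied to the translates
  of \<open>\<alpha>\<close>.\<close>

lemma right_limit_subsequence:
  assumes "\<And>n. cmod (\<alpha> n) \<le> 1" "strict_mono (s :: nat \<Rightarrow> nat)"
  obtains r b where "strict_mono (r :: nat \<Rightarrow> nat)"
    "\<forall>n. (\<lambda>j. \<alpha> (nat (n + int (s (r j))))) \<longlonglongrightarrow> b n"
proof -
  let ?K = "PiE (UNIV :: int set) (\<lambda>_. cball 0 1 :: complex set)"
  have "compactin (product_topology (\<lambda>_. euclidean) UNIV) ?K"
    unfolding compactin_PiE by simp
  then have "compact ?K" by (simp add: euclidean_product_topology)
  then have "seq_compact ?K" by (rule compact_imp_seq_compact)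
  moreover have "(\<lambda>n. \<alpha> (nat (n + int (s j)))) \<in> ?K" for j
    using assms(1) by auto
  ultimately obtain b r where r: "strict_mono (r :: nat \<Rightarrow> nat)"
    and b: "((\<lambda>j n. \<alpha> (nat (n + int (s j)))) \<circ> r) \<longlonglongrightarrow> b"
    unfolding seq_compact_def by metis
  have "\<forall>n. (\<lambda>j. \<alpha> (nat (n + int (s (r j))))) \<longlonglongrightarrow> b n"
    using continuous_on_tendsto_compose[OF continuous_on_product_coordinates b] by (simp add: o_def)
  with r show ?thesis by (rule that)
qed

lemma filterlim_int_strict_mono:
  assumes "strict_mono (s :: nat \<Rightarrow> nat)"
  shows "filterlim (\<lambda>j. int (s j)) at_top sequentially"
  by (rule filterlim_compose[OF filterlim_int_sequentially filterlim_subseq[OF assms]])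

context half_line
begin

lemma right_limit_le:
  assumes "is_right_limit \<alpha> b"
  shows "cmod (b n) \<le> 1"
proof -
  obtain N :: "nat \<Rightarrow> int" where "(\<lambda>j. \<alpha> (nat (n + N j))) \<longlonglongrightarrow> b n"
    using assms unfolding is_right_limit_def by blast
  then show ?thesis
    using \<alpha> by (intro LIMSEQ_le_const2[OF tendsto_norm]) (auto simp: less_imp_le)
qed

text \<open>For each fixed \<open>n\<close> the sites \<open>n + N j\<close> tend to infinity, so
  the limit of the moments is inherited at every site of the right limit.\<close>

lemma right_limit_return_amp:
  assumes "is_right_limit \<alpha> b" "(\<lambda>n. integral\<^sup>L (op_measure \<mu> n) (\<lambda>z. z ^ l)) \<longlonglongrightarrow> d"
  shows "return_amp b l n = d"
proof -
  obtain N where N: "filterlim N at_top sequentially" "\<And>n. (\<lambda>j. \<alpha> (nat (n + N j))) \<longlonglongrightarrow> b n"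
    using assms(1) unfolding is_right_limit_def by blast
  have lim: "filterlim (\<lambda>j. nat (n + N j)) sequentially sequentially"
    unfolding filterlim_at_top
  proof
    fix m
    have "\<forall>\<^sub>F j in sequentially. N j \<ge> int m - n"
      using N(1) by (simp add: filterlim_at_top)
    then show "\<forall>\<^sub>F j in sequentially. m \<le> nat (n + N j)" by eventually_elim simp
  qed
  have "(\<lambda>j. return_amp \<beta> l (int (nat (n + N j)))) \<longlonglongrightarrow> d"
    using filterlim_compose[OF assms(2) lim] by (simp add: op_measure_moments)
  moreover have "\<forall>\<^sub>F j in sequentially. return_amp \<beta> l (int (nat (n + N j))) = return_amp \<beta> l (n + N j)"
  proof -
    have "\<forall>\<^sub>F j in sequentially. N j \<ge> - n"
      using N(1) by (simp add: filterlim_at_top)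
    then show ?thesis by eventually_elim simp
  qed
  ultimately have "(\<lambda>j. return_amp \<beta> l (n + N j)) \<longlonglongrightarrow> d"
    by (rule Lim_transform_eventually)
  then show ?thesis
    using return_amp_right_limit[OF N] LIMSEQ_unique by blast
qed

end

theorem theorem4p8:
  fixes \<alpha> :: "nat \<Rightarrow> complex" and \<mu> :: "complex measure" and k :: nat and c :: complex
  assumes "\<And>n. cmod (\<alpha> n) < 1"
    and "is_spectral_measure (half_line_CMV \<alpha>) (delta 0) \<mu>"
    and "k \<ge> 1" and "cmod c \<le> 1" and "c \<noteq> 0"
    and "\<And>l. l \<in> {1..<k} \<Longrightarrow> (\<lambda>n. integral\<^sup>L (op_measure \<mu> n) (\<lambda>z. z ^ l)) \<longlonglongrightarrow> 0"
    and "(\<lambda>n. integral\<^sup>L (op_measure \<mu> n) (\<lambda>z. z ^ k)) \<longlonglongrightarrow> c"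
    and "convergent (\<lambda>n. integral\<^sup>L (op_measure \<mu> n) (\<lambda>z. z ^ (2 * k)))"
  shows "(\<exists>\<nu>. circle_measure \<nu> \<and> prob_space \<nu> \<and> weak_conv_circle (op_measure \<mu>) \<nu>) \<and>
    (\<exists>\<beta>. is_right_limit \<alpha> \<beta>) \<and>
    (\<forall>\<beta>. is_right_limit \<alpha> \<beta> \<longrightarrow> whole_line_CMV \<beta> \<in> Khrushchev_K c k) \<and>
    (\<forall>\<beta> \<beta>'. is_right_limit \<alpha> \<beta> \<and> is_right_limit \<alpha> \<beta>' \<longrightarrow>
       (\<exists>(\<phi>::real) (m::int). \<forall>n. \<beta>' n = cis \<phi> * \<beta> (n + m)))"
proof -
  interpret half_line \<alpha> \<mu> using assms(1,2) by unfold_locales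
  let ?M = "\<lambda>l n. integral\<^sup>L (op_measure \<mu> n) (\<lambda>z. z ^ l)"
  obtain d where d: "?M (2 * k) \<longlonglongrightarrow> d" using assms(8) by (auto simp: convergent_def)
  have sieved: "\<exists>j. sieved b j k c" if "is_right_limit \<alpha> b" for b
    using sieved_of_return_amp[OF assms(3,5)] right_limit_return_amp[OF that] assms(6,7) by metis
  \<comment> \<open>The limit \<open>d\<close> is the return amplitude after \<open>2 * k\<close>
    steps common to all right limits, which fixes the moduli up to alternation.\<close>
  have unique: "\<exists>\<phi> m. \<forall>n. b' n = cis \<phi> * b (n + m)" if b: "is_right_limit \<alpha> b" "is_right_limit \<alpha> b'" for b b'
  proof -
    obtain j j' where "sieved b j k c" "sieved b' j' k c" using sieved b by blast
    then show ?thesis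
      by (rule sieved_unique[where d = d])
        (use assms(3,5) b right_limit_le right_limit_return_amp[OF _ d] in auto)
  qed
  have const: "return_amp b l n = return_amp b l 0" if b: "is_right_limit \<alpha> b" for b l n
    using sieved[OF b] return_amp_sieved_const[OF _ assms(3,5)] by blast
  \<comment> \<open>A phase leaves return amplitudes unchanged and a shift moves the site, on which
    they do not depend.\<close>
  have same: "return_amp b' l 0 = return_amp b l 0" if b: "is_right_limit \<alpha> b" "is_right_limit \<alpha> b'" for b b' l
  proof -
    obtain \<phi> m where "\<And>n. b' n = cis \<phi> * b (n + m)" using unique[OF b] by blast
    then have "b' = (\<lambda>n. cis \<phi> * b (n + m))" by blast
    then have "return_amp b' l 0 = return_amp b l m"
      using return_amp_phase[of "cis \<phi>" "\<lambda>n. b (n + m)" l 0] return_amp_shift[of b m l 0] by simp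
    then show ?thesis using const[OF b(1)] by simp
  qed
  \<comment> \<open>Along a further subsequence the translates converge to a right limit, and the
    moments converge to its amplitudes at 0.\<close>
  have sub: "\<exists>r b. strict_mono r \<and> is_right_limit \<alpha> b \<and> (\<forall>l. (\<lambda>j. ?M l (s (r j))) \<longlonglongrightarrow> return_amp b l 0)"
    if s: "strict_mono s" for s :: "nat \<Rightarrow> nat"
  proof -
    obtain r b where r: "strict_mono r" and b: "\<forall>n. (\<lambda>j. \<alpha> (nat (n + int (s (r j))))) \<longlonglongrightarrow> b n"
      by (rule right_limit_subsequence[of \<alpha> s, OF less_imp_le[OF assms(1)] s])
    have lim: "filterlim (\<lambda>j. int (s (r j))) at_top sequentially"
      using filterlim_int_strict_mono[OF strict_mono_o[OF s r]] by (simp add: o_def)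
    then have "is_right_limit \<alpha> b" using b unfolding is_right_limit_def by blast
    moreover have "(\<lambda>j. ?M l (s (r j))) \<longlonglongrightarrow> return_amp b l 0" for l
      using return_amp_right_limit[OF lim b[rule_format], of "- 1" l 0] by (simp add: op_measure_moments)
    ultimately show ?thesis using r by blast
  qed
  obtain b0 where b0: "is_right_limit \<alpha> b0" using sub[OF strict_mono_id] by blast
  \<comment> \<open>Subsequence principle: moments that stay away from the claimed limit would
    converge, along a further subsequence, to the amplitude of some right limit, which equals that
    of \<open>b0\<close> by \<open>same\<close>.\<close>
  have moments: "?M l \<longlonglongrightarrow> return_amp b0 l 0" for l
  proof (rule ccontr)
    assume "\<not> ?M l \<longlonglongrightarrow> return_amp b0 l 0"
    then obtain e where e: "e > 0" "\<exists>\<^sub>F n in sequentially. \<not> dist (?M l n) (return_amp b0 l 0) < e"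
      unfolding tendsto_iff by (auto simp: not_eventually)
    then have "infinite {n. \<not> dist (?M l n) (return_amp b0 l 0) < e}"
      by (simp add: frequently_cofinite flip: cofinite_eq_sequentially)
    then obtain s where s: "strict_mono (s :: nat \<Rightarrow> nat)" "\<And>n. \<not> dist (?M l (s n)) (return_amp b0 l 0) < e"
      using infinite_enumerate by blast
    obtain r b where r: "is_right_limit \<alpha> b" "(\<lambda>j. ?M l (s (r j))) \<longlonglongrightarrow> return_amp b l 0"
      using sub[OF s(1)] by blast
    then have "\<forall>\<^sub>F j in sequentially. dist (?M l (s (r j))) (return_amp b0 l 0) < e"
      using e(1) same[OF b0 r(1)] by (simp add: tendsto_iff)
    then show False using s(2) by simp
  qed
  \<comment> \<open>\<open>\<nu>\<close> arises as a weak limit along a subsequence only; once its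
    moments are identified, the moment criterion gives convergence of the whole sequence.\<close>
  obtain r \<nu> where r: "strict_mono (r :: nat \<Rightarrow> nat)" and \<nu>: "circle_measure \<nu>" "prob_space \<nu>"
    and conv: "weak_conv_circle (\<lambda>n. op_measure \<mu> (r n)) \<nu>"
    by (rule circle_measure_convergent_subsequence[OF op_measure_circle op_measure_prob])
  have \<nu>_moments: "integral\<^sup>L \<nu> (\<lambda>z. z ^ l) = return_amp b0 l 0" for l
  proof (rule LIMSEQ_unique)
    show "(\<lambda>n. ?M l (r n)) \<longlonglongrightarrow> integral\<^sup>L \<nu> (\<lambda>z. z ^ l)"
      using conv unfolding weak_conv_circle_def by (simp add: continuous_on_power)
    show "(\<lambda>n. ?M l (r n)) \<longlonglongrightarrow> return_amp b0 l 0"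
      using LIMSEQ_subseq_LIMSEQ[OF moments r] by (simp add: o_def)
  qed
  have "weak_conv_circle (op_measure \<mu>) \<nu>"
    by (rule weak_conv_circle_moments) (use op_measure_circle op_measure_prob \<nu> moments \<nu>_moments in auto)
  moreover have "whole_line_CMV b \<in> Khrushchev_K c k" if b: "is_right_limit \<alpha> b" for b
  proof -
    \<comment> \<open>Amplitudes depend neither on the site nor on the right limit, so
      \<open>\<nu>\<close> serves all \<open>n\<close> at once.\<close>
    have "is_spectral_measure (whole_line_CMV b) (delta n) \<nu>" for n
      unfolding is_spectral_measure_def
      using \<nu>(1) const[OF b] same[OF b0 b] by (simp add: whole_line_CMV_return_amp \<nu>_moments)
    then have "whole_line_CMV b \<in> Khrushchev_class"
      using right_limit_le[OF b] unfolding Khrushchev_class_def whole_line_CMV_matrices_def by blast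
    then show ?thesis
      using right_limit_return_amp[OF b assms(6)] right_limit_return_amp[OF b assms(7)] assms(5)
      by (auto simp: Khrushchev_K_def entry_def whole_line_CMV_return_amp)
  qed
  ultimately show ?thesis using \<nu> b0 unique by blast
qed

end
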